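(* Let $(g_n)\subset L_2$ be a sequence such that $H(g_n)$ converges to some $l\in\mathbb Z\cup\{\pm\infty\}$, and suppose $(g_n)$ is associated with a horofunction $h_{g_n}$. Then, for all $g\in L_2$: (1) If $l\in\mathbb Z$ and $(g_n)$ is both left and right stable, then the sequence is eventually a constant value $g_0$, and $h_{g_n}$ is in the image $i(L_2)$ of $L_2$ in $\overline{L_2}$: $h_{g_n}(g)=d(g,g_0)-d(g_0,id)$. (2) If $l=+\infty$ and $(g_n)$ is left stable, then $h_{g_n}=\mathfrak b^{\gamma}$ for some $[\gamma]\in\partial_\infty L_2^+$, with $\mathfrak b^{\gamma}(g)=\mathfrak b^{+,\gamma}(g)=2(\min\{m(\gamma),0\}-\min\{m(\gamma,g),H(g)\})+H(g)$. (3) If $l=-\infty$ and $(g_n)$ is right stable, then $h_{g_n}=\mathfrak b^{\gamma}$ for some $[\gamma]\in\partial_\infty L_2^-$, with $\mathfrak b^{\gamma}(g)=\mathfrak b^{-,\gamma}(g)=2(\max\{M(\gamma,g)+1,H(g)\}-\max\{M(\gamma)+1,0\})-H(g)$. (4) If $l\in\mathbb Z$ and $(g_n)$ is neither left nor right stable, then $h_{g_n}=\mathfrak s^l$, where $\mathfrak s^l(g)=|l|-|l-H(g)|$. (5) If $l\in\mathbb Z$ and $(g_n)$ is left but not right stable, then $h_{g_n}=\mathfrak r^{+,f}$ for some $f\in L_2$ with $H(f)=l$ and $M(f)<l$, where $\mathfrak r^{+,f}(g)=2(\min\{m(f),l,0\}-\min\{m(f,g),H(g),l\})+\mathfrak s^l(g)$.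 (6) If $l\in\mathbb Z$ and $(g_n)$ is right but not left stable, then $h_{g_n}=\mathfrak r^{-,f}$ for some $f\in L_2$ with $H(f)=l$ and $m(f)\ge l$, where $\mathfrak r^{-,f}(g)=2(\max\{M(f,g)+1,H(g),l\}-\max\{M(f)+1,l,0\})+\mathfrak s^l(g)$. (7) If $l=+\infty$ and $(g_n)$ is not left stable, then $h_{g_n}=H$. (8) If $l=-\infty$ and $(g_n)$ is not right stable, then $h_{g_n}=-H$.
   Context: Lamplighter group: $L_2=\langle a,t\mid a^2,\ [a^{t^i},a^{t^j}]\ \forall i,j\in\mathbb Z\rangle\cong(\bigoplus_{\mathbb Z}\mathbb Z/2)\rtimes\mathbb Z$. Each element is identified with a lamp stand: a finite set of lit lamps (positions in $\mathbb Z$) together with an integer position of the lamplighter. The identity $id$ has no lit lamps and lamplighter at $0$; right multiplication by $a$ toggles the lamp at the lamplighter's position; right multiplication by $t$ moves the lamplighter by $+1$. $d$ is the word metric on $L_2$ with respect to $S=\{t,at\}$, i.e. $d(g,h)$ is the length of $g^{-1}h$ in $S\cup S^{-1}$. $H(g)$ is the lamplighter's position in $g$; $m(g)$ (resp. $M(g)$) is the minimum (resp. maximum) position of a lit lamp of $g$, with $m(g)=+\infty$, $M(g)=-\infty$ if no lamp is lit. $m(g_1,g_2)$ (resp. $M(g_1,g_2)$) is the minimum (resp. maximum) position of a lamp whose status differs in $g_1$ and $g_2$, with value $+\infty$ (resp. $-\infty$) if there is none. $C(L_2)$ is the space of functions $L_2\to\mathbb R$ with the topology of uniform convergence on finite sets;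 $i(z)(x)=d(z,x)-d(z,id)$ embeds $L_2$ in $C(L_2)$; $\overline{L_2}$ is the closure of $i(L_2)$. A sequence $(g_n)$ in $L_2$ is associated with a horofunction if $h_{g_n}(x)=\lim_{n\to\infty}\big(d(g_n,x)-d(g_n,id)\big)$ exists for every $x\in L_2$. A sequence $(g_n)$ is right stable if there exist $N\in\mathbb N$, $K\in\mathbb Z$ such that for every $k>K$ the lamp at position $k$ has the same status (on or off) in all $g_n$ with $n>N$. Left stable is defined similarly, with $k<K$ in place of $k>K$. A geodesic ray is an isometric embedding $\gamma:\mathbb N\to L_2$; two rays are asymptotic if $\sup_n d(\gamma(n),\gamma'(n))<\infty$; $\partial_\infty L_2^{\pm}$ is the set of asymptotic classes $[\gamma]$ of geodesic rays with $\gamma(0)=id$ and $H(\gamma(n))\to\pm\infty$. $\mathfrak b^\gamma=h_{\gamma(n)}$ is the Busemann function of $\gamma$. For such a ray each lamp's status in $\gamma(n)$ is eventually constant; the resulting (possibly infinite) configuration is the infinite lamp stand of $\gamma$, which depends only on $[\gamma]$; $m(\gamma),m(\gamma,g)$ (for $\partial_\infty L_2^+$) and $M(\gamma),M(\gamma,g)$ (for $\partial_\infty L_2^-$) are defined from it as for group elements. *)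

theory Defs
  imports "HOL-Algebra.Generated_Groups" "HOL-Library.FSet" "HOL-Library.Extended_Real"
begin

text \<open>
  An element of the lamplighter group is a lamp stand: the finite set of positions of its lit lamps
  together with the position of the lamplighter.
\<close>

datatype lampstand = Lampstand (lamps: "int fset") (H: int)

text \<open>
  The semidirect product of the finitely supported functions from the integers to Z/2 (represented
  by their supports, added by symmetric difference) with the integers acting by translation.
\<close>

fun lamp_mult :: "lampstand \<Rightarrow> lampstand \<Rightarrow> lampstand" where
  "lamp_mult (Lampstand A p) (Lampstand B q) =
     (let C = (\<lambda>k. k + p) |`| B in Lampstand ((A - C) |\<union>| (C - A)) (p + q))"

definition L2 :: "lampstand monoid" where
  "L2 = \<lparr>carrier = UNIV, monoid.mult = lamp_mult, one = Lampstand {||} 0\<rparr>"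

definition gen_a :: lampstand where "gen_a = Lampstand {|0|} 0"

definition gen_t :: lampstand where "gen_t = Lampstand {||} 1"

definition gens :: "lampstand set" where
  "gens = {gen_t, gen_a \<otimes>\<^bsub>L2\<^esub> gen_t}"

definition lit :: "lampstand \<Rightarrow> int set" where
  "lit g = fset (lamps g)"

lemma lampstand_eqI: "lit g = lit h \<Longrightarrow> H g = H h \<Longrightarrow> g = h"
  by (cases g; cases h) (auto simp: lit_def fset_inject)

lemma H_mult: "H (g \<otimes>\<^bsub>L2\<^esub> h) = H g + H h"
  by (cases g; cases h) (auto simp: L2_def Let_def)

lemma lit_mult_iff: "k \<in> lit (g \<otimes>\<^bsub>L2\<^esub> h) \<longleftrightarrow> (k \<in> lit g) \<noteq> (k - H g \<in> lit h)"
  by (cases g; cases h) (force simp: L2_def lit_def Let_def)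

lemma H_one: "H \<one>\<^bsub>L2\<^esub> = 0" and lit_one: "lit \<one>\<^bsub>L2\<^esub> = {}"
  by (simp_all add: L2_def lit_def)

lemma carrier_L2: "carrier L2 = UNIV"
  by (simp add: L2_def)

lemma group_L2: "group L2"
proof (rule groupI)
  fix x assume "x \<in> carrier L2"
  let ?y = "Lampstand ((\<lambda>k. k - H x) |`| lamps x) (- H x)"
  have "?y \<otimes>\<^bsub>L2\<^esub> x = \<one>\<^bsub>L2\<^esub>"
    by (cases x) (force simp: L2_def Let_def)
  then show "\<exists>y\<in>carrier L2. y \<otimes>\<^bsub>L2\<^esub> x = \<one>\<^bsub>L2\<^esub>"
    by (auto simp: carrier_L2)
qed (auto simp: carrier_L2 H_mult lit_mult_iff H_one lit_one diff_diff_eq intro!: lampstand_eqI)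

lemma mult_gen_a:
  "H (g \<otimes>\<^bsub>L2\<^esub> gen_a) = H g" "lit (g \<otimes>\<^bsub>L2\<^esub> gen_a) = sym_diff (lit g) {H g}"
  by (auto simp: H_mult lit_mult_iff) (auto simp: gen_a_def lit_def)

lemma mult_gen_t:
  "H (g \<otimes>\<^bsub>L2\<^esub> gen_t) = H g + 1" "lit (g \<otimes>\<^bsub>L2\<^esub> gen_t) = lit g"
  by (auto simp: H_mult lit_mult_iff) (auto simp: gen_t_def lit_def)

definition word_length :: "('a, 'b) monoid_scheme \<Rightarrow> 'a set \<Rightarrow> 'a \<Rightarrow> nat" where
  "word_length G S x =
     (LEAST n. \<exists>w. length w = n \<and> set w \<subseteq> S \<union> (\<lambda>s. inv\<^bsub>G\<^esub> s) ` S \<and>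
                   foldr (\<lambda>s y. s \<otimes>\<^bsub>G\<^esub> y) w \<one>\<^bsub>G\<^esub> = x)"

definition d :: "lampstand \<Rightarrow> lampstand \<Rightarrow> nat" where
  "d g h = word_length L2 gens (inv\<^bsub>L2\<^esub> g \<otimes>\<^bsub>L2\<^esub> h)"

text \<open>The set over which \<^const>\<open>word_length\<close> minimises is never empty.\<close>

lemma generate_gens: "generate L2 gens = UNIV"
proof -
  interpret group L2 by (rule group_L2)
  let ?G = "generate L2 gens"
  have mult: "x \<otimes>\<^bsub>L2\<^esub> y \<in> ?G" if "x \<in> ?G" "y \<in> ?G" for x y
    using that by (rule generate.eng)
  have inv_in: "inv\<^bsub>L2\<^esub> x \<in> ?G" if "x \<in> ?G" for x
    using that by (intro generate_m_inv_closed) (auto simp: carrier_L2)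
  have t: "gen_t \<in> ?G" and at: "gen_a \<otimes>\<^bsub>L2\<^esub> gen_t \<in> ?G"
    by (auto simp: gens_def intro: generate.incl)
  have "gen_a = (gen_a \<otimes>\<^bsub>L2\<^esub> gen_t) \<otimes>\<^bsub>L2\<^esub> inv\<^bsub>L2\<^esub> gen_t"
    by (simp add: carrier_L2 m_assoc)
  then have a: "gen_a \<in> ?G"
    using mult[OF at inv_in[OF t]] by simp
  have nat_shift: "Lampstand {||} (int n) \<in> ?G" for n
  proof (induction n)
    case 0
    then show ?case using generate.one[of L2 gens] by (simp add: L2_def)
  next
    case (Suc n)
    have "Lampstand {||} (int n) \<otimes>\<^bsub>L2\<^esub> gen_t = Lampstand {||} (int (Suc n))"
      by (simp add: L2_def gen_t_def)
    then show ?case using mult[OF Suc t] by simp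
  qed
  have shift: "Lampstand {||} p \<in> ?G" for p
  proof (cases "p \<ge> 0")
    case True
    then show ?thesis using nat_shift[of "nat p"] by simp
  next
    case False
    have "Lampstand {||} p \<otimes>\<^bsub>L2\<^esub> Lampstand {||} (- p) = \<one>\<^bsub>L2\<^esub>"
      by (simp add: L2_def)
    then have "inv\<^bsub>L2\<^esub> (Lampstand {||} (- p)) = Lampstand {||} p"
      by (intro inv_equality) (auto simp: carrier_L2)
    then show ?thesis
      using False inv_in[OF nat_shift[of "nat (- p)"]] by simp
  qed
  have single: "Lampstand {|k|} 0 \<in> ?G" for k
  proof -
    have "(Lampstand {||} k \<otimes>\<^bsub>L2\<^esub> gen_a) \<otimes>\<^bsub>L2\<^esub> Lampstand {||} (- k) = Lampstand {|k|} 0"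
      by (simp add: L2_def gen_a_def Let_def)
    then show ?thesis using mult[OF mult[OF shift[of k] a] shift[of "- k"]] by simp
  qed
  have "Lampstand A p \<in> ?G" for A p
  proof (induction A)
    case empty
    then show ?case by (rule shift)
  next
    case (insert k A)
    have "Lampstand {|k|} 0 \<otimes>\<^bsub>L2\<^esub> Lampstand A p = Lampstand (finsert k A) p"
      using insert.hyps by (intro lampstand_eqI) (auto simp: lit_mult_iff H_mult, auto simp: lit_def)
    then show ?case using mult[OF single insert.IH] by metis
  qed
  then show ?thesis by (metis UNIV_eq_I lampstand.exhaust)
qed

text \<open>
  For a nonempty set of integers bounded below (resp. above) these are the minimum (resp. maximum);
  for the empty set they are \<open>\<infinity>\<close> (resp. \<open>-\<infinity>\<close>).
\<close>

definition min_pos :: "int set \<Rightarrow> ereal" where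
  "min_pos A = (INF k\<in>A. ereal (of_int k))"

definition max_pos :: "int set \<Rightarrow> ereal" where
  "max_pos A = (SUP k\<in>A. ereal (of_int k))"

definition horo_embed :: "lampstand \<Rightarrow> lampstand \<Rightarrow> real" where
  "horo_embed z x = real (d z x) - real (d z \<one>\<^bsub>L2\<^esub>)"

definition associated_with_horofunction :: "(nat \<Rightarrow> lampstand) \<Rightarrow> bool" where
  "associated_with_horofunction g \<longleftrightarrow> (\<forall>x. convergent (\<lambda>n. real (d (g n) x) - real (d (g n) \<one>\<^bsub>L2\<^esub>)))"

definition horofunction :: "(nat \<Rightarrow> lampstand) \<Rightarrow> lampstand \<Rightarrow> real" where
  "horofunction g x = lim (\<lambda>n. real (d (g n) x) - real (d (g n) \<one>\<^bsub>L2\<^esub>))"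

definition right_stable :: "(nat \<Rightarrow> lampstand) \<Rightarrow> bool" where
  "right_stable g \<longleftrightarrow> (\<exists>(N::nat) (K::int). \<forall>k>K. \<forall>n>N. \<forall>n'>N. k \<in> lit (g n) \<longleftrightarrow> k \<in> lit (g n'))"

definition left_stable :: "(nat \<Rightarrow> lampstand) \<Rightarrow> bool" where
  "left_stable g \<longleftrightarrow> (\<exists>(N::nat) (K::int). \<forall>k<K. \<forall>n>N. \<forall>n'>N. k \<in> lit (g n) \<longleftrightarrow> k \<in> lit (g n'))"

definition geodesic_ray :: "(nat \<Rightarrow> lampstand) \<Rightarrow> bool" where
  "geodesic_ray \<gamma> \<longleftrightarrow> (\<forall>m n. real (d (\<gamma> m) (\<gamma> n)) = \<bar>real m - real n\<bar>)"

definition rays_plus :: "(nat \<Rightarrow> lampstand) set" where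
  "rays_plus = {\<gamma>. geodesic_ray \<gamma> \<and> \<gamma> 0 = \<one>\<^bsub>L2\<^esub> \<and> filterlim (\<lambda>n. H (\<gamma> n)) at_top sequentially}"

definition rays_minus :: "(nat \<Rightarrow> lampstand) set" where
  "rays_minus = {\<gamma>. geodesic_ray \<gamma> \<and> \<gamma> 0 = \<one>\<^bsub>L2\<^esub> \<and> filterlim (\<lambda>n. H (\<gamma> n)) at_bot sequentially}"

definition asymptotic_on ::
    "(nat \<Rightarrow> lampstand) set \<Rightarrow> ((nat \<Rightarrow> lampstand) \<times> (nat \<Rightarrow> lampstand)) set" where
  "asymptotic_on R = {(\<gamma>, \<gamma>'). \<gamma> \<in> R \<and> \<gamma>' \<in> R \<and> bdd_above (range (\<lambda>n. d (\<gamma> n) (\<gamma>' n)))}"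

definition boundary_plus :: "(nat \<Rightarrow> lampstand) set set" where
  "boundary_plus = rays_plus // asymptotic_on rays_plus"

definition boundary_minus :: "(nat \<Rightarrow> lampstand) set set" where
  "boundary_minus = rays_minus // asymptotic_on rays_minus"

definition busemann :: "(nat \<Rightarrow> lampstand) \<Rightarrow> lampstand \<Rightarrow> real" where
  "busemann \<gamma> = horofunction \<gamma>"

text \<open>The lit lamps of the (possibly infinite) limiting lamp stand of a ray.\<close>

definition ray_lit :: "(nat \<Rightarrow> lampstand) \<Rightarrow> int set" where
  "ray_lit \<gamma> = {k. \<forall>\<^sub>F n in sequentially. k \<in> lit (\<gamma> n)}"

text \<open>
  The explicit formulas take values in \<^typ>\<open>ereal\<close> because \<^const>\<open>min_pos\<close> and \<^const>\<open>max_pos\<close> do.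
\<close>

abbreviation ereal_int :: "int \<Rightarrow> ereal" where
  "ereal_int k \<equiv> ereal (of_int k)"

definition b_plus :: "(nat \<Rightarrow> lampstand) \<Rightarrow> lampstand \<Rightarrow> ereal" where
  "b_plus \<gamma> x =
     2 * (min (min_pos (ray_lit \<gamma>)) 0
          - min (min_pos (sym_diff (ray_lit \<gamma>) (lit x))) (ereal_int (H x)))
     + ereal_int (H x)"

definition b_minus :: "(nat \<Rightarrow> lampstand) \<Rightarrow> lampstand \<Rightarrow> ereal" where
  "b_minus \<gamma> x =
     2 * (max (max_pos (sym_diff (ray_lit \<gamma>) (lit x)) + 1) (ereal_int (H x))
          - max (max_pos (ray_lit \<gamma>) + 1) 0)
     - ereal_int (H x)"

definition s_fun :: "int \<Rightarrow> lampstand \<Rightarrow> real" where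
  "s_fun l x = of_int (\<bar>l\<bar> - \<bar>l - H x\<bar>)"

text \<open>In the next two formulas \<open>l\<close> is the position of the lamplighter in \<open>f\<close>.\<close>

definition r_plus :: "lampstand \<Rightarrow> lampstand \<Rightarrow> ereal" where
  "r_plus f x =
     (let l = H f in
      2 * (min (min_pos (lit f)) (min (ereal_int l) 0)
           - min (min_pos (sym_diff (lit f) (lit x))) (min (ereal_int (H x)) (ereal_int l)))
      + ereal (s_fun l x))"

definition r_minus :: "lampstand \<Rightarrow> lampstand \<Rightarrow> ereal" where
  "r_minus f x =
     (let l = H f in
      2 * (max (max_pos (sym_diff (lit f) (lit x)) + 1) (max (ereal_int (H x)) (ereal_int l))
           - max (max_pos (lit f) + 1) (max (ereal_int l) 0))
      + ereal (s_fun l x))"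

end

(*
  The distance between g and h is 2 (high - low) - |H g - H h|, where [low, high] is the hull of the
  two lamplighter positions and of the edges carrying a lamp that differs.  If H (g n) is eventually
  at least p, existence of the horofunction forces a dichotomy: either the lamps of g n below p are
  eventually constant (left stable), or the leftmost lit lamp escapes to - infinity, and then the
  terms low (g n) x and low (g n) id cancel in the limit.  The mirror isometry yields the same
  dichotomy on the right, and the eight cases are the combinations of the two with the limit of
  H (g n).  A geodesic ray tending to + infinity is itself a left stable sequence, so the same
  computation gives its Busemann function, which depends only on the limiting lamps; conversely,
  every configuration with finitely many lamps to the left of each position is reached by a ray.
*)
theory Submission
  imports Defs
begin

section \<open>The distance formula\<close>

text \<open>Each of \<open>t\<close>, \<open>at\<close> and their inverses moves the lamplighter by
  exactly one and can change only the lamp attached to the edge it crosses. The edge of lamp k has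
  right end k + 1: this is the \<open>+ 1\<close> in the formulas with M, and the reason why M(f) <
  l is strict in one case while m(f) >= l is not in its mirror image. Distances are integers, so a
  convergent difference of distances is eventually constant and every limit becomes an eventual
  equation between integers. The obstacle is that failure of left stability only says that lamps
  arbitrarily far to the left keep changing. That every late lamp stand has a lit lamp there needs
  the existence of the limit, and is extracted from two test points that agree except in one
  lamp.\<close>

interpretation L2: group L2
  by (rule group_L2)

lemma mult_inv_cancel [simp]:
  "g \<otimes>\<^bsub>L2\<^esub> (inv\<^bsub>L2\<^esub> g \<otimes>\<^bsub>L2\<^esub> h) = h" "inv\<^bsub>L2\<^esub> g \<otimes>\<^bsub>L2\<^esub> (g \<otimes>\<^bsub>L2\<^esub> h) = h"
  using L2.m_assoc[of g "inv\<^bsub>L2\<^esub> g" h] L2.m_assoc[of "inv\<^bsub>L2\<^esub> g" g h]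
  by (simp_all add: carrier_L2)

lemma H_inv: "H (inv\<^bsub>L2\<^esub> g) = - H g"
  using H_mult[of g "inv\<^bsub>L2\<^esub> g"] by (simp add: carrier_L2 H_one)

lemma lit_inv_iff: "k \<in> lit (inv\<^bsub>L2\<^esub> g) \<longleftrightarrow> k + H g \<in> lit g"
  using lit_mult_iff[of "k + H g" g "inv\<^bsub>L2\<^esub> g"] by (simp add: carrier_L2 lit_one)

lemma lit_gen_t: "lit gen_t = {}" and H_gen_t: "H gen_t = 1"
  and lit_gen_at: "lit (gen_a \<otimes>\<^bsub>L2\<^esub> gen_t) = {0}" and H_gen_at: "H (gen_a \<otimes>\<^bsub>L2\<^esub> gen_t) = 1"
  by (simp_all add: mult_gen_t) (simp_all add: gen_t_def gen_a_def lit_def)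

lemma finite_lit [simp]: "finite (lit g)"
  by (simp add: lit_def)

text \<open>Witnesses are described as sets of integers, while the constructor wants an
  \<open>fset\<close>; \<open>Abs_fset A\<close> is meaningful only for finite
  \<open>A\<close>.\<close>

definition stand :: "int set \<Rightarrow> int \<Rightarrow> lampstand" where
  "stand A p = Lampstand (Abs_fset A) p"

lemma H_stand [simp]: "H (stand A p) = p"
  by (simp add: stand_def)

lemma lit_stand [simp]: "finite A \<Longrightarrow> lit (stand A p) = A"
  by (simp add: stand_def lit_def Abs_fset_inverse)

abbreviation steps :: "lampstand set" where
  "steps \<equiv> gens \<union> (\<lambda>s. inv\<^bsub>L2\<^esub> s) ` gens"

text \<open>The generators toggle at their starting position 0. The inverse of \<open>at\<close>
  moves left before it toggles, so its lamp is the one at -1.\<close>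

lemma steps_iff:
  "s \<in> steps \<longleftrightarrow> (H s = 1 \<and> lit s \<subseteq> {0}) \<or> (H s = -1 \<and> lit s \<subseteq> {-1})"
proof
  have lits: "lit (inv\<^bsub>L2\<^esub> gen_t) = {}" "lit (inv\<^bsub>L2\<^esub> (gen_a \<otimes>\<^bsub>L2\<^esub> gen_t)) = {-1}"
    by (auto simp: lit_inv_iff lit_gen_t lit_gen_at H_gen_at)
  have eq: "s = h \<longleftrightarrow> H s = H h \<and> lit s = lit h" for h
    using lampstand_eqI by blast
  have "s \<in> steps \<longleftrightarrow> s = gen_t \<or> s = gen_a \<otimes>\<^bsub>L2\<^esub> gen_t \<or>
      s = inv\<^bsub>L2\<^esub> gen_t \<or> s = inv\<^bsub>L2\<^esub> (gen_a \<otimes>\<^bsub>L2\<^esub> gen_t)"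
    unfolding gens_def by blast
  then have *: "s \<in> steps \<longleftrightarrow>
      (H s = 1 \<and> (lit s = {} \<or> lit s = {0})) \<or> (H s = -1 \<and> (lit s = {} \<or> lit s = {-1}))"
    unfolding eq lits H_inv H_gen_t H_gen_at lit_gen_t lit_gen_at by blast
  show "s \<in> steps \<Longrightarrow> (H s = 1 \<and> lit s \<subseteq> {0}) \<or> (H s = -1 \<and> lit s \<subseteq> {-1})"
    using * by auto
  show "(H s = 1 \<and> lit s \<subseteq> {0}) \<or> (H s = -1 \<and> lit s \<subseteq> {-1}) \<Longrightarrow> s \<in> steps"
    unfolding * by (auto simp: subset_singleton_iff)
qed

text \<open>
  A step between the positions \<open>k\<close> and \<open>k + 1\<close>, in either direction, may toggle the lamp \<open>k\<close> and no
  other: lamps behave as if they sat on the edges \<open>[k, k + 1]\<close> of the line.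
\<close>

definition adjacent :: "lampstand \<Rightarrow> lampstand \<Rightarrow> bool" where
  "adjacent g h \<longleftrightarrow> \<bar>H g - H h\<bar> = 1 \<and> (\<forall>k. (k \<in> lit g) \<noteq> (k \<in> lit h) \<longrightarrow> k = min (H g) (H h))"

lemma adjacent_iff: "adjacent g h \<longleftrightarrow> inv\<^bsub>L2\<^esub> g \<otimes>\<^bsub>L2\<^esub> h \<in> steps"
proof -
  have lit: "k \<in> lit (inv\<^bsub>L2\<^esub> g \<otimes>\<^bsub>L2\<^esub> h) \<longleftrightarrow> (k + H g \<in> lit g) \<noteq> (k + H g \<in> lit h)" for k
    by (simp add: lit_mult_iff lit_inv_iff H_inv)
  have sub: "lit (inv\<^bsub>L2\<^esub> g \<otimes>\<^bsub>L2\<^esub> h) \<subseteq> {c} \<longleftrightarrow>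
      (\<forall>k. (k \<in> lit g) \<noteq> (k \<in> lit h) \<longrightarrow> k = H g + c)" for c
  proof
    assume sub: "lit (inv\<^bsub>L2\<^esub> g \<otimes>\<^bsub>L2\<^esub> h) \<subseteq> {c}"
    show "\<forall>k. (k \<in> lit g) \<noteq> (k \<in> lit h) \<longrightarrow> k = H g + c"
    proof (intro allI impI)
      fix k assume "(k \<in> lit g) \<noteq> (k \<in> lit h)"
      then have "k - H g \<in> lit (inv\<^bsub>L2\<^esub> g \<otimes>\<^bsub>L2\<^esub> h)" by (simp add: lit)
      then show "k = H g + c" using sub by auto
    qed
  next
    assume "\<forall>k. (k \<in> lit g) \<noteq> (k \<in> lit h) \<longrightarrow> k = H g + c"
    then show "lit (inv\<^bsub>L2\<^esub> g \<otimes>\<^bsub>L2\<^esub> h) \<subseteq> {c}"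
      unfolding subset_iff lit singleton_iff by (metis add.commute add_left_cancel)
  qed
  have H: "H (inv\<^bsub>L2\<^esub> g \<otimes>\<^bsub>L2\<^esub> h) = H h - H g"
    by (simp add: H_mult H_inv)
  \<comment> \<open>With c = 0 for a move to the right and c = -1 for a move to the left,
    \<open>H g + c\<close> is \<open>min (H g) (H h)\<close> in both cases.\<close>
  consider "H h = H g + 1" | "H h = H g - 1" | "\<bar>H g - H h\<bar> \<noteq> 1" by linarith
  then show ?thesis
    unfolding steps_iff sub adjacent_def H by cases auto
qed

definition low :: "lampstand \<Rightarrow> lampstand \<Rightarrow> int" where
  "low g h = Min (insert (H g) (insert (H h) (sym_diff (lit g) (lit h))))"

lemma le_low_iff:
  "c \<le> low g h \<longleftrightarrow> c \<le> H g \<and> c \<le> H h \<and> (\<forall>k. (k \<in> lit g) \<noteq> (k \<in> lit h) \<longrightarrow> c \<le> k)"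
  unfolding low_def by (subst Min_ge_iff) auto

lemma low_le: "low g h \<le> H g" "low g h \<le> H h" "(k \<in> lit g) \<noteq> (k \<in> lit h) \<Longrightarrow> low g h \<le> k"
  using le_low_iff[of "low g h" g h] by auto

lemma low_cases:
  obtains "low g h = H g" | "low g h = H h" | "(low g h \<in> lit g) \<noteq> (low g h \<in> lit h)"
proof -
  have "low g h \<in> insert (H g) (insert (H h) (sym_diff (lit g) (lit h)))"
    unfolding low_def by (rule Min_in) auto
  then show ?thesis using that by blast
qed

lemma low_commute: "low g h = low h g"
  unfolding low_def by (simp add: insert_commute Un_commute)

text \<open>
  Reflecting the line maps the edge \<open>[k, k + 1]\<close> to the edge \<open>[- 1 - k, - k]\<close>; this is an isometry that
  exchanges left and right.
\<close>

definition mirror :: "lampstand \<Rightarrow> lampstand" where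
  "mirror g = Lampstand ((\<lambda>k. - 1 - k) |`| lamps g) (- H g)"

lemma H_mirror [simp]: "H (mirror g) = - H g"
  by (simp add: mirror_def)

lemma lit_mirror: "lit (mirror g) = (\<lambda>k. - 1 - k) ` lit g"
  by (simp add: mirror_def lit_def)

lemma lit_mirror_iff [simp]: "k \<in> lit (mirror g) \<longleftrightarrow> - 1 - k \<in> lit g"
  by (force simp: lit_mirror)

lemma mirror_mirror [simp]: "mirror (mirror g) = g"
  by (rule lampstand_eqI) auto

lemma all_reflect: "(\<forall>k. P (- 1 - k)) \<longleftrightarrow> (\<forall>k. P k)" for P :: "int \<Rightarrow> bool"
proof
  assume P: "\<forall>k. P (- 1 - k)"
  show "\<forall>k. P k"
  proof
    fix k
    show "P k" using P[rule_format, of "- 1 - k"] by simp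
  qed
qed simp

lemma adjacent_mirror: "adjacent (mirror g) (mirror h) \<longleftrightarrow> adjacent g h"
proof -
  have lit: "(\<forall>k. (k \<in> lit (mirror g)) \<noteq> (k \<in> lit (mirror h)) \<longrightarrow> k = m) \<longleftrightarrow>
      (\<forall>k. (k \<in> lit g) \<noteq> (k \<in> lit h) \<longrightarrow> k = - 1 - m)" for m
    using all_reflect[of "\<lambda>k. (k \<in> lit g) \<noteq> (k \<in> lit h) \<longrightarrow> k = - 1 - m"] by simp
  show ?thesis
  proof (cases "\<bar>H g - H h\<bar> = 1")
    case True
    then have "- 1 - min (- H g) (- H h) = min (H g) (H h)" by linarith
    then show ?thesis
      unfolding adjacent_def lit using True by (simp add: abs_minus_commute)
  next
    case False
    then show ?thesis unfolding adjacent_def by (simp add: abs_minus_commute)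
  qed
qed

text \<open>Going through \<open>mirror\<close> makes the left-right symmetry hold by definition. A
  differing lamp k contributes - (-1 - k) = k + 1, the right end of its edge, whence the strict
  inequality in \<open>high_le_iff\<close>.\<close>

definition high :: "lampstand \<Rightarrow> lampstand \<Rightarrow> int" where
  "high g h = - low (mirror g) (mirror h)"

lemma high_le_iff:
  "high g h \<le> c \<longleftrightarrow> H g \<le> c \<and> H h \<le> c \<and> (\<forall>k. (k \<in> lit g) \<noteq> (k \<in> lit h) \<longrightarrow> k < c)"
proof -
  from all_reflect[of "\<lambda>k. (k \<in> lit g) \<noteq> (k \<in> lit h) \<longrightarrow> -c \<le> -1-k"]
  show ?thesis
    using le_low_iff[of "-c" "mirror g" "mirror h"] unfolding high_def
    by (simp add: minus_le_iff) (smt (verit))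
qed

lemma high_ge: "H g \<le> high g h" "H h \<le> high g h" "(k \<in> lit g) \<noteq> (k \<in> lit h) \<Longrightarrow> k < high g h"
  using high_le_iff[of g h "high g h"] by auto

lemma low_mirror: "low (mirror g) (mirror h) = - high g h"
  and high_mirror: "high (mirror g) (mirror h) = - low g h"
  by (simp_all add: high_def)

text \<open>
  The length of a shortest path from \<open>H g\<close> to \<open>H h\<close> that covers \<open>[low g h, high g h]\<close>, the hull of both
  positions and of the edges of all lamps to be changed.
\<close>

definition tour :: "lampstand \<Rightarrow> lampstand \<Rightarrow> int" where
  "tour g h = 2 * (high g h - low g h) - \<bar>H g - H h\<bar>"

lemma tour_mirror: "tour (mirror g) (mirror h) = tour g h"
  by (simp add: tour_def low_mirror high_mirror abs_minus_commute)

lemma tour_commute: "tour g h = tour h g"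
  by (simp add: tour_def high_def low_commute abs_minus_commute)

lemma tour_nonneg: "0 \<le> tour g h"
  using low_le(1,2)[where g=g and h=h] high_ge(1,2)[where g=g and h=h] by (simp add: tour_def)

lemma tour_self [simp]: "tour g g = 0"
  by (simp add: tour_def high_def low_def)

text \<open>Both positions lie in the hull, so \<open>tour\<close> is at least its length. Length 0
  leaves room for no edge, hence for no differing lamp.\<close>

lemma tour_eq_0_iff: "tour g h = 0 \<longleftrightarrow> g = h"
proof
  assume 0: "tour g h = 0"
  then have eq: "high g h = low g h"
    using low_le(1,2)[where g=g and h=h] high_ge(1,2)[where g=g and h=h] by (simp add: tour_def)
  then have "H g = H h"
    using low_le(1,2)[where g=g and h=h] high_ge(1,2)[where g=g and h=h] by simp
  moreover have "lit g = lit h"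
    using low_le(3)[where g=g and h=h] high_ge(3)[where g=g and h=h] eq by fastforce
  ultimately show "g = h" by (simp add: lampstand_eqI)
qed simp

text \<open>By reflection the move goes right. The hull for \<open>g\<close> exceeds the hull for
  \<open>g'\<close> by at most the edge at \<open>H g\<close>. If that edge is new on the left, then
  \<open>H h\<close> lies to the right of \<open>H g\<close>, and the increase of 2 is offset by 1
  in the subtracted distance of the positions; otherwise only that distance changes.\<close>

lemma tour_le_adjacent:
  assumes "adjacent g g'"
  shows "tour g h \<le> tour g' h + 1"
proof -
  have aux: "tour g h \<le> tour g' h + 1" if "adjacent g g'" "H g' = H g + 1" for g g' h
  proof -
    have diff: "(k \<in> lit g) \<noteq> (k \<in> lit h) \<longrightarrow> (k \<in> lit g') \<noteq> (k \<in> lit h) \<or> k = H g" for k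
      using that unfolding adjacent_def by (auto simp: min_def)
    have hi: "high g h \<le> high g' h"
      unfolding high_le_iff using high_ge[where g=g' and h=h] that diff by smt
    have lo: "min (H g) (low g' h) \<le> low g h"
      unfolding le_low_iff using low_le[where g=g' and h=h] diff by smt
    show ?thesis
      using hi lo low_le(1,2)[where g=g' and h=h] that(2) unfolding tour_def by (auto simp: min_def split: if_splits)
  qed
  show ?thesis
  proof (cases "H g' = H g + 1")
    case True
    then show ?thesis using aux assms by blast
  next
    case False
    then have "H (mirror g') = H (mirror g) + 1"
      using assms by (auto simp: adjacent_def)
    then have "tour (mirror g) (mirror h) \<le> tour (mirror g') (mirror h) + 1"
      using aux assms adjacent_mirror by blast
    then show ?thesis by (simp add: tour_mirror)
  qed
qed

text \<open>A greedy first step of an optimal path. If \<open>H g <= H h\<close>, such a path clears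
  everything on the left first, then sweeps right; each crossed edge gets its final lamp status at
  once. The other case is the reflection.\<close>

lemma tour_less_adjacent:
  assumes "g \<noteq> h"
  obtains g' where "adjacent g g'" "tour g h = tour g' h + 1"
proof -
  have aux: "\<exists>g'. adjacent g g' \<and> tour g h = tour g' h + 1" if "H g \<le> H h" "g \<noteq> h" for g h
  proof (cases "low g h < H g")
    case True
    define g' where "g' = stand (if H g - 1 \<in> lit h then insert (H g - 1) (lit g) else lit g - {H g - 1}) (H g - 1)"
    have H: "H g' = H g - 1" and lit: "k \<in> lit g' \<longleftrightarrow> (if k = H g - 1 then k \<in> lit h else k \<in> lit g)" for k
      by (auto simp: g'_def)
    have "low g h = low g' h"
    proof (rule antisym)
      show "low g h \<le> low g' h"
        unfolding le_low_iff H lit using True low_le[where g=g and h=h] by auto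
      show "low g' h \<le> low g h"
      proof (cases rule: low_cases[of g h])
        case 3
        show ?thesis
        \<comment> \<open>If the crossed lamp itself attained the left end, it is now correct, and
          the new position \<open>H g - 1\<close> attains the end instead. The hull stays the same,
          and the gain comes from the larger distance between the positions.\<close>
        proof (cases "low g h = H g - 1")
          case True
          then show ?thesis using low_le(1)[of g' h] H by simp
        next
          case False
          then show ?thesis using low_le(3)[of "low g h" g' h] lit 3 by metis
        qed
      qed (use True that in auto)
    qed
    moreover have "high g h = high g' h"
    proof (rule antisym)
      have "k < high g' h" if "(k \<in> lit g) \<noteq> (k \<in> lit h)" for k
        using that high_ge(3)[of k g' h] high_ge(2)[where g=g' and h=h] lit[of k] \<open>H g \<le> H h\<close>
        by (cases "k = H g - 1") auto
      then show "high g h \<le> high g' h"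
        unfolding high_le_iff using high_ge(2)[where g=g' and h=h] that by force
      show "high g' h \<le> high g h"
        unfolding high_le_iff H lit using high_ge[where g=g and h=h] by fastforce
    qed
    moreover have "adjacent g g'"
      unfolding adjacent_def lit H by auto
    ultimately show ?thesis
      using that H by (intro exI[of _ g']) (auto simp: tour_def)
  next
    case False
    then have low: "low g h = H g" using low_le(1)[of g h] by simp
    define g' where "g' = stand (if H g \<in> lit h then insert (H g) (lit g) else lit g - {H g}) (H g + 1)"
    have H: "H g' = H g + 1" and lit: "k \<in> lit g' \<longleftrightarrow> (if k = H g then k \<in> lit h else k \<in> lit g)" for k
      by (auto simp: g'_def)
    have ge: "H g \<le> k" if "(k \<in> lit g) \<noteq> (k \<in> lit h)" for k
      using low_le(3)[OF that] low by simp
    \<comment> \<open>This puts the new position \<open>H g + 1\<close> inside the old hull;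
      otherwise the hull is a point and \<open>g = h\<close>.\<close>
    have less: "H g < high g h"
    proof (rule ccontr)
      assume *: "\<not> H g < high g h"
      then have "H g = H h" "\<And>k. (k \<in> lit g) = (k \<in> lit h)"
        using high_ge[where g=g and h=h] ge \<open>H g \<le> H h\<close> by force+
      then show False using lampstand_eqI[of g h] \<open>g \<noteq> h\<close> by auto
    qed
    \<comment> \<open>The left end advances by one if \<open>H g < H h\<close>. If the positions
      coincide it stays, and the gain comes from their distance growing from 0 to 1.\<close>
    have low': "low g' h = min (H g + 1) (H h)"
    proof (rule antisym)
      have "H g + 1 \<le> k" if "(k \<in> lit g') \<noteq> (k \<in> lit h)" for k
        using that lit[of k] ge[of k] by (cases "k = H g") auto
      then show "min (H g + 1) (H h) \<le> low g' h"
        unfolding le_low_iff H by force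
    qed (use low_le(1,2)[where g=g' and h=h] H in auto)
    have high: "high g h = high g' h"
    proof (rule antisym)
      have "k < high g' h" if "(k \<in> lit g) \<noteq> (k \<in> lit h)" for k
        using that high_ge(3)[of k g' h] high_ge(1)[where g=g' and h=h] lit[of k] H
        by (cases "k = H g") auto
      then show "high g h \<le> high g' h"
        unfolding high_le_iff using high_ge(1,2)[where g=g' and h=h] H by force
      show "high g' h \<le> high g h"
        unfolding high_le_iff H lit using high_ge[where g=g and h=h] less by fastforce
    qed
    moreover have "adjacent g g'"
      unfolding adjacent_def lit H by auto
    ultimately show ?thesis
      using that(1) H low low' by (intro exI[of _ g']) (auto simp: tour_def min_def abs_if)
  qed
  show ?thesis
  proof (cases "H g \<le> H h")
    case True
    then show ?thesis using aux assms that by blast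
  next
    case False
    have "mirror g \<noteq> mirror h" using assms mirror_mirror by metis
    then obtain g' where "adjacent (mirror g) g'" "tour (mirror g) (mirror h) = tour g' (mirror h) + 1"
      using aux[of "mirror g" "mirror h"] False by auto
    then show ?thesis
      using that[of "mirror g'"] adjacent_mirror[of "mirror g" g'] adjacent_mirror[of g "mirror g'"]
        tour_mirror[of g' "mirror h"] tour_mirror[of g h] by simp
  qed
qed

section \<open>Word length equals tour length\<close>

abbreviation word_prod :: "lampstand list \<Rightarrow> lampstand" where
  "word_prod w \<equiv> foldr (\<lambda>s y. s \<otimes>\<^bsub>L2\<^esub> y) w \<one>\<^bsub>L2\<^esub>"

text \<open>Reading a word letter by letter, the tour still needed to the fixed target drops by at
  most one per letter.\<close>

lemma tour_le_length:
  assumes "set w \<subseteq> steps"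
  shows "tour g (g \<otimes>\<^bsub>L2\<^esub> word_prod w) \<le> int (length w)"
  using assms
proof (induction w arbitrary: g)
  case Nil
  then show ?case by (simp add: carrier_L2)
next
  case (Cons s w)
  have "adjacent g (g \<otimes>\<^bsub>L2\<^esub> s)"
    using Cons.prems unfolding adjacent_iff by simp
  then have "tour g (g \<otimes>\<^bsub>L2\<^esub> word_prod (s # w)) \<le> tour (g \<otimes>\<^bsub>L2\<^esub> s) (g \<otimes>\<^bsub>L2\<^esub> word_prod (s # w)) + 1"
    by (rule tour_le_adjacent)
  also have "g \<otimes>\<^bsub>L2\<^esub> word_prod (s # w) = (g \<otimes>\<^bsub>L2\<^esub> s) \<otimes>\<^bsub>L2\<^esub> word_prod w"
    by (simp add: L2.m_assoc carrier_L2)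
  finally show ?case using Cons.IH[of "g \<otimes>\<^bsub>L2\<^esub> s"] Cons.prems by (simp add: L2.m_assoc carrier_L2)
qed

text \<open>Iterating the greedy step spells a word whose length is exactly the tour.\<close>

lemma ex_word_tour:
  "\<exists>w. int (length w) = tour g h \<and> set w \<subseteq> steps \<and> g \<otimes>\<^bsub>L2\<^esub> word_prod w = h"
proof (induction "nat (tour g h)" arbitrary: g)
  case 0
  then have "g = h" using tour_nonneg[of g h] tour_eq_0_iff[of g h] by simp
  then show ?case by (intro exI[of _ "[]"]) (simp add: carrier_L2)
next
  case (Suc n)
  then have "g \<noteq> h" by auto
  then obtain g' where g': "adjacent g g'" "tour g h = tour g' h + 1"
    by (rule tour_less_adjacent)
  then obtain w where w: "int (length w) = tour g' h" "set w \<subseteq> steps" "g' \<otimes>\<^bsub>L2\<^esub> word_prod w = h"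
    using Suc.hyps(1)[of g'] Suc.hyps(2) tour_nonneg[of g' h] by fastforce
  let ?s = "inv\<^bsub>L2\<^esub> g \<otimes>\<^bsub>L2\<^esub> g'"
  have "g \<otimes>\<^bsub>L2\<^esub> word_prod (?s # w) = (g \<otimes>\<^bsub>L2\<^esub> ?s) \<otimes>\<^bsub>L2\<^esub> word_prod w"
    using L2.m_assoc[of g ?s "word_prod w"] by (simp add: carrier_L2)
  then have "g \<otimes>\<^bsub>L2\<^esub> word_prod (?s # w) = h" using w(3) by simp
  then show ?case
    using w g' adjacent_iff[of g g'] by (intro exI[of _ "?s # w"]) auto
qed

lemma d_tour: "int (d g h) = tour g h"
proof -
  have prod_iff: "word_prod w = inv\<^bsub>L2\<^esub> g \<otimes>\<^bsub>L2\<^esub> h \<longleftrightarrow> g \<otimes>\<^bsub>L2\<^esub> word_prod w = h" for w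
    by (metis mult_inv_cancel)
  have "d g h = nat (tour g h)"
    unfolding d_def word_length_def prod_iff
  proof (rule Least_equality)
    show "\<exists>w. length w = nat (tour g h) \<and> set w \<subseteq> steps \<and> g \<otimes>\<^bsub>L2\<^esub> word_prod w = h"
      using ex_word_tour[of g h] by (metis nat_int)
  next
    fix n assume "\<exists>w. length w = n \<and> set w \<subseteq> steps \<and> g \<otimes>\<^bsub>L2\<^esub> word_prod w = h"
    then show "nat (tour g h) \<le> n"
      using tour_le_length by (metis nat_le_iff)
  qed
  then show ?thesis
    using tour_nonneg[of g h] by simp
qed

lemma d_commute: "d g h = d h g"
  using tour_commute[of g h] by (simp flip: d_tour)

lemma d_mirror: "d (mirror g) (mirror h) = d g h"
  using tour_mirror[of g h] by (simp flip: d_tour)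

lemma mirror_one [simp]: "mirror \<one>\<^bsub>L2\<^esub> = \<one>\<^bsub>L2\<^esub>"
  by (rule lampstand_eqI) (auto simp: H_one lit_one)

text \<open>Along a greedy path from \<open>g\<close> to \<open>h\<close>, the tour to
  \<open>k\<close> falls by at most one per step.\<close>

lemma tour_triangle: "tour g k \<le> tour g h + tour h k"
proof (induction "nat (tour g h)" arbitrary: g)
  case 0
  then have "g = h" using tour_nonneg[of g h] tour_eq_0_iff[of g h] by simp
  then show ?case by simp
next
  case (Suc n)
  then have "g \<noteq> h" by auto
  then obtain g' where g': "adjacent g g'" "tour g h = tour g' h + 1"
    by (rule tour_less_adjacent)
  then have "tour g' k \<le> tour g' h + tour h k"
    using Suc.hyps(1)[of g'] Suc.hyps(2) tour_nonneg[of g' h] by fastforce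
  then show ?case using g' tour_le_adjacent[of g g' k] by linarith
qed

lemma d_triangle: "d g k \<le> d g h + d h k"
  using tour_triangle[of g k h] by (simp flip: d_tour)

section \<open>Stabilisation of the lamps\<close>

text \<open>Two integers within 1/2 of the same real number are equal.\<close>

lemma eventually_const_of_tendsto_int:
  fixes Y :: "nat \<Rightarrow> int"
  assumes "(\<lambda>n. real_of_int (Y n)) \<longlonglongrightarrow> L"
  shows "\<exists>c. L = of_int c \<and> (\<forall>\<^sub>F n in sequentially. Y n = c)"
proof -
  have near: "\<forall>\<^sub>F n in sequentially. \<bar>real_of_int (Y n) - L\<bar> < 1/2"
    using tendstoD[OF assms, of "1/2"] by (simp add: dist_real_def)
  then obtain N where N: "\<And>n. n \<ge> N \<Longrightarrow> \<bar>real_of_int (Y n) - L\<bar> < 1/2"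
    unfolding eventually_sequentially by blast
  have "Y n = Y N" if "n \<ge> N" for n
    using N[OF that] N[of N] by linarith
  then have ev: "\<forall>\<^sub>F n in sequentially. Y n = Y N"
    unfolding eventually_sequentially by blast
  then have "(\<lambda>n. real_of_int (Y n)) \<longlonglongrightarrow> of_int (Y N)"
    by (intro tendsto_eventually) (auto elim: eventually_mono)
  then have "L = of_int (Y N)"
    using assms LIMSEQ_unique by blast
  then show ?thesis using ev by blast
qed

lemma horofunction_eventually:
  assumes "associated_with_horofunction g"
  obtains c where "horofunction g x = of_int c"
    "\<forall>\<^sub>F n in sequentially. tour (g n) x - tour (g n) \<one>\<^bsub>L2\<^esub> = c"
proof -
  have "(\<lambda>n. real (d (g n) x) - real (d (g n) \<one>\<^bsub>L2\<^esub>)) \<longlonglongrightarrow> horofunction g x"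
    using assms unfolding associated_with_horofunction_def horofunction_def
    by (simp add: convergent_LIMSEQ_iff)
  then have "(\<lambda>n. real_of_int (tour (g n) x - tour (g n) \<one>\<^bsub>L2\<^esub>)) \<longlonglongrightarrow> horofunction g x"
    by (simp flip: d_tour)
  from eventually_const_of_tendsto_int[OF this] show ?thesis
    using that by blast
qed

lemma horofunction_eqI:
  assumes "\<forall>\<^sub>F n in sequentially. tour (g n) x - tour (g n) \<one>\<^bsub>L2\<^esub> = c"
  shows "horofunction g x = of_int c"
proof -
  have "real (d (g n) x) - real (d (g n) \<one>\<^bsub>L2\<^esub>) =
      real_of_int (tour (g n) x - tour (g n) \<one>\<^bsub>L2\<^esub>)" for n
    by (simp flip: d_tour)
  then have "(\<lambda>n. real (d (g n) x) - real (d (g n) \<one>\<^bsub>L2\<^esub>)) \<longlonglongrightarrow> of_int c"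
    by (intro tendsto_eventually) (use assms in \<open>auto elim: eventually_mono\<close>)
  then show ?thesis
    unfolding horofunction_def by (rule limI)
qed

text \<open>\<open>mirror\<close> is an isometric involution fixing the identity, so it carries
  horofunctions to horofunctions with the same normalisation.\<close>

lemma horofunction_mirror:
  "associated_with_horofunction (mirror \<circ> g) \<longleftrightarrow> associated_with_horofunction g"
  "horofunction (mirror \<circ> g) (mirror x) = horofunction g x"
proof -
  have *: "d (mirror h) x = d h (mirror x)" for h x
    using d_mirror[of h "mirror x"] by simp
  have **: "d (mirror h) \<one>\<^bsub>L2\<^esub> = d h \<one>\<^bsub>L2\<^esub>" for h
    using *[of h "\<one>\<^bsub>L2\<^esub>"] by simp
  show "horofunction (mirror \<circ> g) (mirror x) = horofunction g x"
    unfolding horofunction_def o_def ** * by simp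
  show "associated_with_horofunction (mirror \<circ> g) \<longleftrightarrow> associated_with_horofunction g"
    unfolding associated_with_horofunction_def o_def ** unfolding * by (metis mirror_mirror)
qed

lemma ex_bound_reflect: "(\<exists>K. \<forall>k<K. P (- 1 - k)) \<longleftrightarrow> (\<exists>K. \<forall>k>K. P k)" for P :: "int \<Rightarrow> bool"
proof
  assume "\<exists>K. \<forall>k<K. P (- 1 - k)"
  then obtain K where K: "\<And>k. k < K \<Longrightarrow> P (- 1 - k)" by blast
  have "P k" if "k > - 1 - K" for k
    using K[of "- 1 - k"] that by simp
  then show "\<exists>K. \<forall>k>K. P k" by blast
next
  assume "\<exists>K. \<forall>k>K. P k"
  then obtain K where K: "\<And>k. k > K \<Longrightarrow> P k" by blast
  have "P (- 1 - k)" if "k < - 1 - K" for k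
    using K[of "- 1 - k"] that by simp
  then show "\<exists>K. \<forall>k<K. P (- 1 - k)" by blast
qed

lemma stable_mirror: "left_stable (mirror \<circ> g) \<longleftrightarrow> right_stable g"
  unfolding left_stable_def right_stable_def o_def lit_mirror_iff
  by (subst ex_bound_reflect) (rule refl)

text \<open>A lamp left of \<open>H x\<close> has the right end of its edge at most
  \<open>H x\<close>, which the hull contains anyway. Here the test point varies; in
  \<open>low_cong\<close> it is the member of the sequence.\<close>

lemma high_cong:
  assumes "H x = H y" "\<And>k. k \<ge> H x \<Longrightarrow> k \<in> lit x \<longleftrightarrow> k \<in> lit y"
  shows "high g x = high g y"
proof -
  have "high g x \<le> c \<longleftrightarrow> high g y \<le> c" for c
    unfolding high_le_iff using assms by (metis not_le order_less_le_trans)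
  then show ?thesis by (metis order_antisym order_refl)
qed

lemma low_cong:
  assumes "H g = H h" "\<And>k. k < H g \<Longrightarrow> k \<in> lit g \<longleftrightarrow> k \<in> lit h"
  shows "low g x = low h x"
proof -
  have "c \<le> low g x \<longleftrightarrow> c \<le> low h x" for c
    unfolding le_low_iff using assms by (metis not_le order_trans nle_le)
  then show ?thesis by (metis order_antisym order_refl)
qed

text \<open>All of \<open>x\<close> and of the identity lies to the left of \<open>H g\<close>, so
  the right end is decided by \<open>g\<close> alone.\<close>

lemma high_far:
  assumes "H x \<le> H g" "lit x \<subseteq> {..<H g}" "0 \<le> H g"
  shows "high g x = high g \<one>\<^bsub>L2\<^esub>"
proof -
  have "high g x \<le> c \<longleftrightarrow> high g \<one>\<^bsub>L2\<^esub> \<le> c" for c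
    unfolding high_le_iff H_one lit_one using assms by (force simp: subset_iff)
  then show ?thesis by (metis order_antisym order_refl)
qed

text \<open>A disagreement with \<open>g\<close> left of \<open>p - 1\<close> is seen equally by
  both test points. A gap of exactly one can therefore only mean that \<open>g\<close> agrees with
  \<open>x\<close> everywhere below \<open>p\<close> and meets its first disagreement with
  \<open>y\<close> at \<open>p - 1\<close>.\<close>

lemma lit_below_of_low_diff:
  assumes "H x = p" "H y = p" "sym_diff (lit x) (lit y) = {p - 1}" "lit x \<subseteq> {..<p}"
    and "low g x = low g y + 1" "p \<le> H g"
  shows "lit g \<inter> {..<p} = lit x"
proof -
  have agree: "k \<in> lit x \<longleftrightarrow> k \<in> lit y" if "k \<noteq> p - 1" for k
    using assms(3) that by blast
  have "low g x = p"
  proof (rule ccontr)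
    assume "low g x \<noteq> p"
    then have less: "low g y < p - 1"
      using low_le(2)[of g x] assms(1,5) by linarith
    then have "(low g y \<in> lit g) \<noteq> (low g y \<in> lit y)"
      using assms(2,6) by (cases rule: low_cases[of g y]) auto
    then have "low g x \<le> low g y"
      using low_le(3)[of "low g y" g x] agree[of "low g y"] less by simp
    then show False using assms(5) by simp
  qed
  then have "k \<in> lit g \<longleftrightarrow> k \<in> lit x" if "k < p" for k
    using low_le(3)[of k g x] that by fastforce
  then show ?thesis using assms(4) by auto
qed

text \<open>
  Two test points whose lamps differ only at \<open>p - 1\<close> tell whether the lamps of \<open>g n\<close> below \<open>p\<close>
  agree with a given configuration.
\<close>

lemma stabilise_or_escape:
  assumes assoc: "associated_with_horofunction g"
    and H: "\<forall>\<^sub>F n in sequentially. p \<le> H (g n)"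
  shows "(\<exists>C. \<forall>\<^sub>F n in sequentially. lit (g n) \<inter> {..<p} = C) \<or>
         (\<forall>K. \<forall>\<^sub>F n in sequentially. \<exists>k\<in>lit (g n). k < K)"
proof (rule disjCI)
  assume "\<not> (\<forall>K. \<forall>\<^sub>F n in sequentially. \<exists>k\<in>lit (g n). k < K)"
  then obtain K where K: "\<exists>\<^sub>F n in sequentially. \<forall>k\<in>lit (g n). K \<le> k"
    by (auto simp: not_eventually not_less)
  \<comment> \<open>Infinitely often all lit lamps are at least \<open>K\<close>; only finitely many
    configurations fit between \<open>K\<close> and \<open>p\<close>, so one of them recurs.\<close>
  have "\<exists>C\<in>Pow {K..<p}. \<exists>\<^sub>F n in sequentially. lit (g n) \<inter> {..<p} = C"
  proof (rule ccontr)
    assume "\<not> ?thesis"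
    then have "\<forall>C\<in>Pow {K..<p}. \<forall>\<^sub>F n in sequentially. lit (g n) \<inter> {..<p} \<noteq> C"
      by (simp add: not_frequently)
    then have "\<forall>\<^sub>F n in sequentially. \<forall>C\<in>Pow {K..<p}. lit (g n) \<inter> {..<p} \<noteq> C"
      by (intro eventually_ball_finite) auto
    then have "\<forall>\<^sub>F n in sequentially. \<not> (\<forall>k\<in>lit (g n). K \<le> k)"
    proof (rule eventually_mono)
      fix n assume *: "\<forall>C\<in>Pow {K..<p}. lit (g n) \<inter> {..<p} \<noteq> C"
      show "\<not> (\<forall>k\<in>lit (g n). K \<le> k)"
      proof
        assume "\<forall>k\<in>lit (g n). K \<le> k"
        then have "lit (g n) \<inter> {..<p} \<in> Pow {K..<p}" by auto
        then show False using * by blast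
      qed
    qed
    then show False using K unfolding frequently_def by contradiction
  qed
  then obtain C where C: "C \<subseteq> {K..<p}" "\<exists>\<^sub>F n in sequentially. lit (g n) \<inter> {..<p} = C"
    by blast
  \<comment> \<open>\<open>x\<close> copies the recurring configuration and \<open>y\<close> spoils
    its last lamp below \<open>p\<close>. Both have the same position and the same lamps from
    \<open>p\<close> on, so the \<open>high\<close> terms cancel and the two horofunction values
    compare the \<open>low\<close> terms only.\<close>
  define x where "x = stand C p"
  define y where "y = stand (sym_diff C {p - 1}) p"
  have "finite C" using C(1) finite_subset by blast
  then have x: "H x = p" "lit x = C" and y: "H y = p" "lit y = sym_diff C {p - 1}"
    by (auto simp: x_def y_def)
  have high: "high h x = high h y" for h
    using x y by (intro high_cong) auto
  obtain a where a: "\<forall>\<^sub>F n in sequentially. tour (g n) x - tour (g n) \<one>\<^bsub>L2\<^esub> = a"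
    by (rule horofunction_eventually[OF assoc, of x])
  obtain b where b: "\<forall>\<^sub>F n in sequentially. tour (g n) y - tour (g n) \<one>\<^bsub>L2\<^esub> = b"
    by (rule horofunction_eventually[OF assoc, of y])
  from a b have diff: "\<forall>\<^sub>F n in sequentially. 2 * (low (g n) y - low (g n) x) = a - b"
    by eventually_elim (simp add: tour_def high x y)
  have "\<exists>\<^sub>F n in sequentially. lit (g n) \<inter> {..<p} = C \<and> p \<le> H (g n) \<and> 2 * (low (g n) y - low (g n) x) = a - b"
    using frequently_eventually_conj[OF C(2) eventually_conj[OF H diff]] by (simp add: conj_commute)
  \<comment> \<open>One recurrence time late enough for the constants \<open>a\<close> and
    \<open>b\<close> shows that the eventual gap is 1; this gap then forces the configuration
    \<open>C\<close> at all late times.\<close>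
  then obtain n where n: "lit (g n) \<inter> {..<p} = C" "p \<le> H (g n)" "2 * (low (g n) y - low (g n) x) = a - b"
    by (auto dest: frequently_ex)
  have iff: "k \<in> lit (g n) \<longleftrightarrow> k \<in> C" if "k < p" for k
    using n(1) that by auto
  have "low (g n) x = p"
  proof (rule antisym)
    have "p \<le> k" if "(k \<in> lit (g n)) \<noteq> (k \<in> lit x)" for k
      using that iff[of k] x by (cases "k < p") auto
    then show "p \<le> low (g n) x"
      unfolding le_low_iff using n(2) x by auto
  qed (use low_le(2)[of "g n" x] x in simp)
  moreover have "low (g n) y = p - 1"
  proof (rule antisym)
    show "low (g n) y \<le> p - 1"
      using iff[of "p - 1"] y by (intro low_le(3)) auto
    have "p - 1 \<le> k" if "(k \<in> lit (g n)) \<noteq> (k \<in> lit y)" for k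
      using that iff[of k] y by (cases "k < p") auto
    then show "p - 1 \<le> low (g n) y"
      unfolding le_low_iff using n(2) y by auto
  qed
  ultimately have "\<forall>\<^sub>F n in sequentially. low (g n) x = low (g n) y + 1"
    using diff n(3) by (auto elim: eventually_mono)
  then have "\<forall>\<^sub>F n in sequentially. lit (g n) \<inter> {..<p} = C"
    using H
  proof eventually_elim
    case (elim n)
    have "sym_diff (lit x) (lit y) = {p - 1}" "lit x \<subseteq> {..<p}"
      unfolding x y using C(1) by auto
    then show ?case
      using lit_below_of_low_diff[OF x(1) y(1)] x(2) elim by simp
  qed
  then show "\<exists>C. \<forall>\<^sub>F n in sequentially. lit (g n) \<inter> {..<p} = C" by (rule exI)
qed

text \<open>The definition controls the lamps only to the left of some unspecified bound. Since the
  two alternatives of the dichotomy imply stability and instability respectively, control extends to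
  every \<open>p\<close> that the lamplighter eventually stays at or beyond.\<close>

lemma left_stable_iff:
  assumes "associated_with_horofunction g" "\<forall>\<^sub>F n in sequentially. p \<le> H (g n)"
  shows "left_stable g \<longleftrightarrow> (\<exists>C. \<forall>\<^sub>F n in sequentially. lit (g n) \<inter> {..<p} = C)"
    and "\<not> left_stable g \<longleftrightarrow> (\<forall>K. \<forall>\<^sub>F n in sequentially. \<exists>k\<in>lit (g n). k < K)"
proof -
  have 1: "left_stable g" if ev: "\<forall>\<^sub>F n in sequentially. lit (g n) \<inter> {..<p} = C" for C
  proof -
    obtain N where N: "\<And>n. n \<ge> N \<Longrightarrow> lit (g n) \<inter> {..<p} = C"
      using ev unfolding eventually_sequentially by blast
    have "k \<in> lit (g n) \<longleftrightarrow> k \<in> C" if "n > N" "k < p" for n k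
      using N[of n] that by auto
    then show ?thesis unfolding left_stable_def by blast
  qed
  have 2: "\<not> left_stable g" if ev: "\<forall>K. \<forall>\<^sub>F n in sequentially. \<exists>k\<in>lit (g n). k < K"
  proof
    assume "left_stable g"
    then obtain N K where NK: "\<And>k n n'. k < K \<Longrightarrow> n > N \<Longrightarrow> n' > N \<Longrightarrow> k \<in> lit (g n) \<longleftrightarrow> k \<in> lit (g n')"
      unfolding left_stable_def by blast
    \<comment> \<open>A lit lamp left of \<open>K\<close> and of all lamps of one fixed late member
      has changed its status.\<close>
    define m where "m = Min (insert K (lit (g (Suc N))))"
    have m: "m \<le> K" "\<And>k. k \<in> lit (g (Suc N)) \<Longrightarrow> m \<le> k"
      by (auto simp: m_def)
    have "\<forall>\<^sub>F n in sequentially. n > N \<and> (\<exists>k\<in>lit (g n). k < m)"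
      using eventually_gt_at_top ev by (intro eventually_conj) auto
    then obtain n k where "n > N" "k \<in> lit (g n)" "k < m"
      by (auto dest!: eventually_happens'[OF sequentially_bot])
    then show False using NK[of k n "Suc N"] m by force
  qed
  show "left_stable g \<longleftrightarrow> (\<exists>C. \<forall>\<^sub>F n in sequentially. lit (g n) \<inter> {..<p} = C)"
    "\<not> left_stable g \<longleftrightarrow> (\<forall>K. \<forall>\<^sub>F n in sequentially. \<exists>k\<in>lit (g n). k < K)"
    using 1 2 stabilise_or_escape[OF assms] by blast+
qed

text \<open>\<open>ray_lit\<close> makes sense for any sequence; it names the limit configuration of
  \<open>g\<close>, which is later realised by a ray. Finiteness below each \<open>p\<close> is what
  makes this possible.\<close>

lemma left_stable_ray_lit:
  assumes "associated_with_horofunction g" "\<forall>\<^sub>F n in sequentially. p \<le> H (g n)" "left_stable g"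
  shows "\<forall>\<^sub>F n in sequentially. lit (g n) \<inter> {..<p} = ray_lit g \<inter> {..<p}"
    and "finite (ray_lit g \<inter> {..<p})"
proof -
  obtain C where C: "\<forall>\<^sub>F n in sequentially. lit (g n) \<inter> {..<p} = C"
    using assms left_stable_iff(1) by blast
  have "k \<in> ray_lit g \<longleftrightarrow> k \<in> C" if "k < p" for k
  proof -
    have "\<forall>\<^sub>F n in sequentially. k \<in> lit (g n) \<longleftrightarrow> k \<in> C"
      using C by (rule eventually_mono) (use that in blast)
    then have "(\<forall>\<^sub>F n in sequentially. k \<in> lit (g n)) \<longleftrightarrow> (\<forall>\<^sub>F n in sequentially. k \<in> C)" for n :: nat
      by (rule eventually_cong)
    then show ?thesis by (simp add: ray_lit_def)
  qed
  moreover obtain n where "lit (g n) \<inter> {..<p} = C"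
    using C by (auto dest: eventually_happens'[OF sequentially_bot])
  moreover from this have "finite C" by (metis finite_Int finite_lit)
  ultimately have "ray_lit g \<inter> {..<p} = C" by auto
  then show "\<forall>\<^sub>F n in sequentially. lit (g n) \<inter> {..<p} = ray_lit g \<inter> {..<p}"
    "finite (ray_lit g \<inter> {..<p})"
    using C \<open>finite C\<close> by auto
qed

text \<open>A lamp of \<open>g\<close> beyond everything in \<open>x\<close> and \<open>y\<close>
  pushes the left end of the hull below \<open>K\<close>. There it is attained by a lamp at which
  \<open>x\<close> and \<open>y\<close> are both off, so it counts for \<open>y\<close> as well;
  exchanging the roles gives equality.\<close>

lemma low_le_of_far_lamp:
  assumes "k \<in> lit g" "k < K" "K \<le> H g"
    and "\<And>j. j \<in> insert (H x) (lit x) \<union> insert (H y) (lit y) \<Longrightarrow> K \<le> j"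
  shows "low g y \<le> low g x"
proof -
  have "k \<notin> lit x" using assms(2) assms(4)[of k] by auto
  then have "low g x < K" using low_le(3)[of k g x] assms(1,2) by simp
  moreover from this have "low g x \<notin> lit x" "low g x \<notin> lit y"
    using assms(4)[of "low g x"] by auto
  moreover have "low g x \<noteq> H g" "low g x \<noteq> H x"
    using calculation(1) assms(3) assms(4)[of "H x"] by auto
  ultimately show ?thesis
    using low_le(3)[of "low g x" g y] by (cases rule: low_cases[of g x]) blast+
qed

lemma eventually_low_eq:
  assumes "associated_with_horofunction g" "\<forall>\<^sub>F n in sequentially. p \<le> H (g n)" "\<not> left_stable g"
  shows "\<forall>\<^sub>F n in sequentially. low (g n) x = low (g n) y"
proof -
  define K where "K = Min (insert p (insert (H x) (lit x) \<union> insert (H y) (lit y)))"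
  have K: "K \<le> p" "\<And>j. j \<in> insert (H x) (lit x) \<union> insert (H y) (lit y) \<Longrightarrow> K \<le> j"
    unfolding K_def by (rule Min_le; auto)+
  have "\<forall>\<^sub>F n in sequentially. \<exists>k\<in>lit (g n). k < K"
    using assms left_stable_iff(2) by blast
  then show ?thesis
    using assms(2)
  proof eventually_elim
    case (elim n)
    then obtain k where "k \<in> lit (g n)" "k < K" "K \<le> H (g n)" using K(1) by auto
    then show ?case
      using K(2) by (intro antisym; intro low_le_of_far_lamp[of k _ K]) auto
  qed
qed

lemma tour_diff: "tour g x - tour g y =
    2 * (high g x - high g y) + 2 * (low g y - low g x) - \<bar>H g - H x\<bar> + \<bar>H g - H y\<bar>"
  by (simp add: tour_def)

section \<open>Limits of the distance functions\<close>

text \<open>The limit configuration is compared with \<open>g n\<close> only to the left of a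
  position; the minimum with that position hides all other lamps.\<close>

lemma min_pos_cut:
  assumes "A \<inter> {..<q} = B \<inter> {..<q}"
  shows "min (min_pos A) (ereal_int q) = min (min_pos B) (ereal_int q)"
proof -
  have "min (min_pos A) (ereal_int q) \<le> min (min_pos B) (ereal_int q)"
    if "A \<inter> {..<q} = B \<inter> {..<q}" for A B
  proof -
    have "min (min_pos A) (ereal_int q) \<le> ereal_int k" if k: "k \<in> B" for k
    proof (cases "k < q")
      case True
      then have "k \<in> A" using k \<open>A \<inter> {..<q} = B \<inter> {..<q}\<close> by blast
      then have "min_pos A \<le> ereal_int k" unfolding min_pos_def by (rule INF_lower)
      then show ?thesis by (rule min.coboundedI1)
    qed (simp add: min_le_iff_disj)
    then show ?thesis
      unfolding min_pos_def[of B] by (intro min.boundedI INF_greatest) simp_all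
  qed
  from this[OF assms] this[OF assms[symmetric]] show ?thesis by (rule antisym)
qed

text \<open>The bridge between the integer hull and the extended real formulas: without a differing
  lamp \<open>min_pos\<close> is infinite and the positions decide.\<close>

lemma ereal_low:
  "ereal_int (low g x) = min (min_pos (sym_diff (lit g) (lit x))) (min (ereal_int (H g)) (ereal_int (H x)))"
proof (rule antisym)
  show "ereal_int (low g x) \<le> min (min_pos (sym_diff (lit g) (lit x))) (min (ereal_int (H g)) (ereal_int (H x)))"
    unfolding min_pos_def
    using low_le(1,2)[where g=g and h=x] low_le(3)[where g=g and h=x]
    by (intro min.boundedI INF_greatest) auto
  show "min (min_pos (sym_diff (lit g) (lit x))) (min (ereal_int (H g)) (ereal_int (H x))) \<le> ereal_int (low g x)"
  proof (cases rule: low_cases[of g x])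
    case 3
    then have "low g x \<in> sym_diff (lit g) (lit x)" by blast
    then have "min_pos (sym_diff (lit g) (lit x)) \<le> ereal_int (low g x)"
      unfolding min_pos_def by (rule INF_lower)
    then show ?thesis by (rule min.coboundedI1)
  qed (simp_all add: min_le_iff_disj)
qed

text \<open>This is \<open>tour f x\<close> minus the tour from \<open>f\<close> to the identity,
  with the \<open>high\<close> terms left out.\<close>

lemma r_plus_eq: "r_plus f x = ereal_int (2 * (low f \<one>\<^bsub>L2\<^esub> - low f x) + \<bar>H f\<bar> - \<bar>H f - H x\<bar>)"
proof -
  have "min (min_pos (lit f)) (min (ereal_int (H f)) 0) = ereal_int (low f \<one>\<^bsub>L2\<^esub>)"
    by (simp add: ereal_low lit_one H_one zero_ereal_def)
  moreover have "min (min_pos (sym_diff (lit f) (lit x))) (min (ereal_int (H x)) (ereal_int (H f))) = ereal_int (low f x)"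
    by (simp add: ereal_low min.commute)
  ultimately show ?thesis
    unfolding r_plus_def Let_def s_fun_def by (simp add: algebra_simps)
qed

lemma eventually_high_eq:
  assumes "associated_with_horofunction g" "\<forall>\<^sub>F n in sequentially. H (g n) \<le> p" "\<not> right_stable g"
  shows "\<forall>\<^sub>F n in sequentially. high (g n) x = high (g n) y"
proof -
  have "\<forall>\<^sub>F n in sequentially. low ((mirror \<circ> g) n) (mirror x) = low ((mirror \<circ> g) n) (mirror y)"
    using assms eventually_low_eq[of "mirror \<circ> g" "- p" "mirror x" "mirror y"]
    by (simp add: horofunction_mirror stable_mirror)
  then show ?thesis by (simp add: low_mirror)
qed

section \<open>Sequences whose lamplighter has a finite limit\<close>

lemma horofunction_left_right_unstable:
  assumes assoc: "associated_with_horofunction g" and H: "\<forall>\<^sub>F n in sequentially. H (g n) = p"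
    and "\<not> left_stable g" "\<not> right_stable g"
  shows "horofunction g = s_fun p"
proof
  fix x
  have low: "\<forall>\<^sub>F n in sequentially. low (g n) x = low (g n) \<one>\<^bsub>L2\<^esub>"
    by (rule eventually_low_eq[OF assoc _ \<open>\<not> left_stable g\<close>, of p])
      (use H in \<open>simp add: eventually_mono\<close>)
  have high: "\<forall>\<^sub>F n in sequentially. high (g n) x = high (g n) \<one>\<^bsub>L2\<^esub>"
    by (rule eventually_high_eq[OF assoc _ \<open>\<not> right_stable g\<close>, of p])
      (use H in \<open>simp add: eventually_mono\<close>)
  have "\<forall>\<^sub>F n in sequentially. tour (g n) x - tour (g n) \<one>\<^bsub>L2\<^esub> = \<bar>p\<bar> - \<bar>p - H x\<bar>"
    using H low high by eventually_elim (simp add: tour_diff H_one)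
  then show "horofunction g x = s_fun p x"
    unfolding s_fun_def by (rule horofunction_eqI)
qed

lemma horofunction_both_stable:
  assumes assoc: "associated_with_horofunction g" and H: "\<forall>\<^sub>F n in sequentially. H (g n) = p"
    and "left_stable g" "right_stable g"
  shows "\<exists>g\<^sub>0. (\<forall>\<^sub>F n in sequentially. g n = g\<^sub>0) \<and> horofunction g = horo_embed g\<^sub>0"
proof -
  have assoc': "associated_with_horofunction (mirror \<circ> g)" and stable': "left_stable (mirror \<circ> g)"
    using assms by (simp_all add: horofunction_mirror stable_mirror)
  have ge: "\<forall>\<^sub>F n in sequentially. p \<le> H (g n)" "\<forall>\<^sub>F n in sequentially. - p \<le> H ((mirror \<circ> g) n)"
    using H by (auto elim: eventually_mono)
  have "\<forall>\<^sub>F n in sequentially. H (g n) = p \<and> lit (g n) \<inter> {..<p} = ray_lit g \<inter> {..<p} \<and>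
      lit (mirror (g n)) \<inter> {..<- p} = ray_lit (mirror \<circ> g) \<inter> {..<- p}"
    using left_stable_ray_lit(1)[OF assoc ge(1) \<open>left_stable g\<close>]
      left_stable_ray_lit(1)[OF assoc' ge(2) stable'] H
    by eventually_elim simp
  then obtain N where N: "\<And>n. n \<ge> N \<Longrightarrow> H (g n) = p \<and> lit (g n) \<inter> {..<p} = ray_lit g \<inter> {..<p} \<and>
      lit (mirror (g n)) \<inter> {..<- p} = ray_lit (mirror \<circ> g) \<inter> {..<- p}"
    unfolding eventually_sequentially by blast
  have "g n = g N" if "n \<ge> N" for n
  proof (rule lampstand_eqI)
    show "H (g n) = H (g N)" using N[OF that] N[of N] by simp
    have below: "lit (g n) \<inter> {..<p} = lit (g N) \<inter> {..<p}"
      and above: "lit (mirror (g n)) \<inter> {..<- p} = lit (mirror (g N)) \<inter> {..<- p}"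
      using N[OF that] N[of N] by simp_all
    have "k \<in> lit (g n) \<longleftrightarrow> k \<in> lit (g N)" for k
    proof (cases "k < p")
      case True
      then show ?thesis using below by blast
    next
      case False
      \<comment> \<open>The reflection of a lamp \<open>k >= p\<close> lies below
        \<open>- p\<close>, so left stability of the sequence and of its mirror image together
        control all lamps.\<close>
      then have "- 1 - k \<in> {..<- p}" by simp
      then have "- 1 - k \<in> lit (mirror (g n)) \<longleftrightarrow> - 1 - k \<in> lit (mirror (g N))"
        using above by blast
      then show ?thesis by simp
    qed
    then show "lit (g n) = lit (g N)" by blast
  qed
  then have ev: "\<forall>\<^sub>F n in sequentially. g n = g N"
    unfolding eventually_sequentially by blast
  have "horofunction g x = horo_embed (g N) x" for x
  proof -
    have "horofunction g x = of_int (tour (g N) x - tour (g N) \<one>\<^bsub>L2\<^esub>)"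
      using ev by (intro horofunction_eqI) (auto elim: eventually_mono)
    then show ?thesis unfolding horo_embed_def by (simp flip: d_tour)
  qed
  then show ?thesis using ev by blast
qed

lemma horofunction_left_stable_right_unstable:
  assumes assoc: "associated_with_horofunction g" and H: "\<forall>\<^sub>F n in sequentially. H (g n) = p"
    and "left_stable g" "\<not> right_stable g"
  shows "\<exists>f. H f = p \<and> max_pos (lit f) < ereal_int p \<and> (\<forall>x. ereal (horofunction g x) = r_plus f x)"
proof -
  have ge: "\<forall>\<^sub>F n in sequentially. p \<le> H (g n)"
    using H by (rule eventually_mono) simp
  define C where "C = ray_lit g \<inter> {..<p}"
  have C: "\<forall>\<^sub>F n in sequentially. lit (g n) \<inter> {..<p} = C" "finite C"
    using left_stable_ray_lit[OF assoc ge \<open>left_stable g\<close>] by (simp_all add: C_def)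
  have sub: "C \<subseteq> {..<p}" by (simp add: C_def)
  \<comment> \<open>Cutting the limit configuration at \<open>p\<close> is harmless for
    \<open>low\<close>, while the lamps from \<open>p\<close> on, which need not settle, enter only
    \<open>high\<close>, whose contributions cancel.\<close>
  let ?f = "stand C p"
  \<comment> \<open>A supremum of values below \<open>p\<close> is only known to be at most
    \<open>p\<close>; integrality gives the bound \<open>p - 1\<close> and hence strictness.\<close>
  have "max_pos C \<le> ereal_int (p - 1)"
    unfolding max_pos_def using sub by (intro SUP_least) (force simp: subset_iff)
  also have "\<dots> < ereal_int p" by simp
  finally have max: "max_pos C < ereal_int p" .
  have "ereal (horofunction g x) = r_plus ?f x" for x
  proof -
    have high: "\<forall>\<^sub>F n in sequentially. high (g n) x = high (g n) \<one>\<^bsub>L2\<^esub>"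
      by (rule eventually_high_eq[OF assoc _ \<open>\<not> right_stable g\<close>, of p])
        (use H in \<open>simp add: eventually_mono\<close>)
    have "\<forall>\<^sub>F n in sequentially. tour (g n) x - tour (g n) \<one>\<^bsub>L2\<^esub> =
        2 * (low ?f \<one>\<^bsub>L2\<^esub> - low ?f x) + \<bar>p\<bar> - \<bar>p - H x\<bar>"
      using H C(1) high
    proof eventually_elim
      case (elim n)
      have "low (g n) y = low ?f y" for y
        using elim C(2) by (intro low_cong) auto
      then show ?case using elim by (simp add: tour_diff H_one)
    qed
    then show ?thesis
      unfolding r_plus_eq H_stand by (simp add: horofunction_eqI)
  qed
  then show ?thesis
    using max C(2) by (intro exI[of _ ?f]) simp
qed

section \<open>The explicit formulas under reflection\<close>

lemma mirror_image_lit: "(\<lambda>k. - 1 - k) ` A = {k. - 1 - k \<in> A}" for A :: "int set"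
  by force

lemma min_pos_reflect: "min_pos {k. - 1 - k \<in> A} = - (max_pos A + 1)"
proof -
  have "min_pos ((\<lambda>k. - 1 - k) ` A) = (INF k\<in>A. - (ereal_int k + 1))"
    unfolding min_pos_def image_image by (simp add: one_ereal_def algebra_simps)
  also have "\<dots> = - (SUP k\<in>A. ereal_int k + 1)"
    by (rule ereal_INF_uminus_eq)
  also have "(SUP k\<in>A. ereal_int k + 1) = max_pos A + 1"
  \<comment> \<open>For the empty set both sides are -infinity, which absorbs the 1; pulling the
    summand out of the supremum needs a nonempty set.\<close>
  proof (cases "A = {}")
    case True
    then show ?thesis by (simp add: max_pos_def bot_ereal_def)
  next
    case False
    then show ?thesis unfolding max_pos_def by (rule SUP_ereal_add_left) simp
  qed
  finally show ?thesis by (simp add: mirror_image_lit)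
qed

lemma lit_mirror_Collect: "lit (mirror x) = {k. - 1 - k \<in> lit x}"
  by (simp add: lit_mirror mirror_image_lit)

lemma ray_lit_mirror: "ray_lit (mirror \<circ> g) = {k. - 1 - k \<in> ray_lit g}"
  by (simp add: ray_lit_def)

lemma sym_diff_Collect: "sym_diff {k. P k \<in> A} {k. P k \<in> B} = {k. P k \<in> sym_diff A B}"
  by blast

lemma min_uminus_ereal: "min (- a) (- b) = - max a b" for a b :: ereal
  by (auto simp: min_def max_def)

lemma r_minus_mirror: "r_minus f x = r_plus (mirror f) (mirror x)"
proof -
  have s: "s_fun (- p) (mirror x) = s_fun p x" for p
    by (simp add: s_fun_def)
  have 0: "min (- a) 0 = - max a 0" for a :: ereal
    using min_uminus_ereal[of a 0] by simp
  have int: "ereal_int (- k) = - ereal_int k" for k by simp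
  \<comment> \<open>Only commutativity of addition is involved, so infinite values are
    allowed.\<close>
  have eq: "- a - - b = b - a" for a b :: ereal
    by (simp add: minus_ereal_def add.commute)
  show ?thesis
    unfolding r_minus_def r_plus_def Let_def lit_mirror_Collect sym_diff_Collect min_pos_reflect
      H_mirror int 0 min_uminus_ereal s eq ..
qed

lemma b_minus_mirror: "b_minus \<gamma> x = b_plus (mirror \<circ> \<gamma>) (mirror x)"
proof -
  have 0: "min (- a) 0 = - max a 0" for a :: ereal
    using min_uminus_ereal[of a 0] by simp
  have int: "ereal_int (- k) = - ereal_int k" for k by simp
  have eq: "- a + - (- b) = b + - a" for a b :: ereal
    by (simp add: add.commute)
  show ?thesis
    unfolding b_minus_def b_plus_def ray_lit_mirror lit_mirror_Collect sym_diff_Collect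
      min_pos_reflect H_mirror int 0 min_uminus_ereal minus_ereal_def eq ..
qed

section \<open>Sequences whose lamplighter tends to +infinity\<close>

lemma tour_far:
  assumes "H x \<le> H g" "lit x \<subseteq> {..<H g}" "0 \<le> H g"
  shows "tour g x - tour g \<one>\<^bsub>L2\<^esub> = 2 * (low g \<one>\<^bsub>L2\<^esub> - low g x) + H x"
  \<comment> \<open>The \<open>high\<close> terms cancel, and the two distances between positions
    leave \<open>- (H g - H x) + H g = H x\<close>.\<close>
  using assms high_far[OF assms] by (simp add: tour_diff H_one)

lemma eventually_tour_far:
  assumes "\<And>p. \<forall>\<^sub>F n in sequentially. p \<le> H (g n)"
  shows "\<forall>\<^sub>F n in sequentially. tour (g n) x - tour (g n) \<one>\<^bsub>L2\<^esub> =
    2 * (low (g n) \<one>\<^bsub>L2\<^esub> - low (g n) x) + H x"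
proof -
  define p where "p = Max (insert 0 (insert (H x) ((\<lambda>k. k + 1) ` lit x)))"
  have p: "0 \<le> p" "H x \<le> p" "\<And>k. k \<in> lit x \<Longrightarrow> k + 1 \<le> p"
    unfolding p_def by (rule Max_ge; simp)+
  show ?thesis
    using assms[of p]
  proof eventually_elim
    case (elim n)
    have "k < H (g n)" if "k \<in> lit x" for k
      using p(3)[OF that] elim by simp
    then show ?case using p(1,2) elim by (intro tour_far) auto
  qed
qed

lemma horofunction_escape:
  assumes assoc: "associated_with_horofunction g"
    and H: "\<And>p. \<forall>\<^sub>F n in sequentially. p \<le> H (g n)" and "\<not> left_stable g"
  shows "horofunction g x = of_int (H x)"
proof -
  have "\<forall>\<^sub>F n in sequentially. tour (g n) x - tour (g n) \<one>\<^bsub>L2\<^esub> = H x"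
    using eventually_tour_far[OF H, of x]
      eventually_low_eq[OF assoc H[of 0] \<open>\<not> left_stable g\<close>, of x "\<one>\<^bsub>L2\<^esub>"]
    by eventually_elim simp
  then show ?thesis by (rule horofunction_eqI)
qed

lemma horofunction_left_stable:
  assumes assoc: "associated_with_horofunction g"
    and H: "\<And>p. \<forall>\<^sub>F n in sequentially. p \<le> H (g n)" and "left_stable g"
  shows "ereal (horofunction g x) = b_plus g x"
proof -
  have low: "\<forall>\<^sub>F n in sequentially.
      ereal_int (low (g n) y) = min (min_pos (sym_diff (ray_lit g) (lit y))) (ereal_int (H y))" for y
    using left_stable_ray_lit(1)[OF assoc H[of "H y"] \<open>left_stable g\<close>] H[of "H y"]
  proof eventually_elim
    case (elim n)
    have "min (ereal_int (H (g n))) (ereal_int (H y)) = ereal_int (H y)"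
      using elim(2) by (intro min.absorb2) simp
    moreover have "sym_diff (lit (g n)) (lit y) \<inter> {..<H y} = sym_diff (ray_lit g) (lit y) \<inter> {..<H y}"
      using elim(1) by blast
    ultimately show ?case unfolding ereal_low by (metis min_pos_cut)
  qed
  have "\<forall>\<^sub>F n in sequentially. ereal_int (tour (g n) x - tour (g n) \<one>\<^bsub>L2\<^esub>) = b_plus g x"
    using low[of x] low[of "\<one>\<^bsub>L2\<^esub>"] eventually_tour_far[OF H, of x]
  proof eventually_elim
    case (elim n)
    have "min (min_pos (ray_lit g)) 0 = ereal_int (low (g n) \<one>\<^bsub>L2\<^esub>)"
      using elim(2) by (simp add: lit_one H_one zero_ereal_def)
    then show ?case
      unfolding b_plus_def elim(1)[symmetric] elim(3) by simp
  qed
  moreover obtain c where c: "horofunction g x = of_int c"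
    "\<forall>\<^sub>F n in sequentially. tour (g n) x - tour (g n) \<one>\<^bsub>L2\<^esub> = c"
    by (rule horofunction_eventually[OF assoc])
  \<comment> \<open>One common index suffices to identify the integer limit with the extended real
    formula.\<close>
  ultimately obtain n where "ereal_int (tour (g n) x - tour (g n) \<one>\<^bsub>L2\<^esub>) = b_plus g x"
    "tour (g n) x - tour (g n) \<one>\<^bsub>L2\<^esub> = c"
    using eventually_happens'[OF sequentially_bot eventually_conj] by blast
  then show ?thesis using c(1) by simp
qed

section \<open>Geodesic rays\<close>

lemma rays_plusD:
  assumes "\<gamma> \<in> rays_plus"
  shows "real (d (\<gamma> m) (\<gamma> n)) = \<bar>real m - real n\<bar>" "d (\<gamma> n) \<one>\<^bsub>L2\<^esub> = n"
    "\<forall>\<^sub>F n in sequentially. p \<le> H (\<gamma> n)"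
proof -
  show *: "real (d (\<gamma> m) (\<gamma> n)) = \<bar>real m - real n\<bar>" for m n
    using assms by (simp add: rays_plus_def geodesic_ray_def)
  show "d (\<gamma> n) \<one>\<^bsub>L2\<^esub> = n"
    using *[of n 0] assms by (simp add: rays_plus_def)
  show "\<forall>\<^sub>F n in sequentially. p \<le> H (\<gamma> n)"
    using assms by (simp add: rays_plus_def filterlim_at_top)
qed

text \<open>The usual argument for Busemann functions: by the triangle inequality the differences
  decrease along the ray and are bounded by the distance of \<open>x\<close> from the
  identity.\<close>

lemma associated_ray:
  assumes "\<gamma> \<in> rays_plus"
  shows "associated_with_horofunction \<gamma>"
  unfolding associated_with_horofunction_def
proof
  fix x
  let ?X = "\<lambda>n. real (d (\<gamma> n) x) - real (d (\<gamma> n) \<one>\<^bsub>L2\<^esub>)"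
  have "?X (Suc n) \<le> ?X n" for n
  proof -
    have "d (\<gamma> (Suc n)) (\<gamma> n) = 1"
      using rays_plusD(1)[OF assms, of "Suc n" n] by simp
    then show ?thesis
      using d_triangle[of "\<gamma> (Suc n)" x "\<gamma> n"] by (simp add: rays_plusD(2)[OF assms])
  qed
  then have "decseq ?X" by (intro decseq_SucI)
  moreover have "\<bar>?X n\<bar> \<le> real (d x \<one>\<^bsub>L2\<^esub>)" for n
    using d_triangle[of "\<gamma> n" x "\<one>\<^bsub>L2\<^esub>"] d_triangle[of "\<gamma> n" "\<one>\<^bsub>L2\<^esub>" x] d_commute[of x "\<one>\<^bsub>L2\<^esub>"]
    by linarith
  then have "Bseq ?X" by (intro BseqI') simp
  ultimately show "convergent ?X"
    using Bseq_monoseq_convergent monoseq_iff by blast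
qed

text \<open>
  An escaping ray would have the horofunction \<^const>\<open>H\<close>, yet a Busemann function tends to \<open>-\<infinity>\<close>
  along its own ray.
\<close>

lemma left_stable_ray:
  assumes "\<gamma> \<in> rays_plus"
  shows "left_stable \<gamma>"
proof (rule ccontr)
  assume "\<not> left_stable \<gamma>"
  then have eq: "horofunction \<gamma> x = of_int (H x)" for x
    using horofunction_escape associated_ray rays_plusD(3) assms by blast
  have "horofunction \<gamma> (\<gamma> m) = of_int (- int m)" for m
  proof (rule horofunction_eqI)
    show "\<forall>\<^sub>F n in sequentially. tour (\<gamma> n) (\<gamma> m) - tour (\<gamma> n) \<one>\<^bsub>L2\<^esub> = - int m"
      using eventually_ge_at_top[of m]
    proof eventually_elim
      case (elim n)
      then have "d (\<gamma> n) (\<gamma> m) = n - m"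
        using rays_plusD(1)[OF assms, of n m] by simp
      then show ?case
        using elim rays_plusD(2)[OF assms, of n] by (simp flip: d_tour)
    qed
  qed
  then have "H (\<gamma> m) \<le> 0" for m
    unfolding eq by (metis of_int_eq_iff neg_le_0_iff_le of_nat_0_le_iff)
  moreover obtain n where "1 \<le> H (\<gamma> n)"
    using eventually_happens'[OF sequentially_bot rays_plusD(3)[OF assms, of 1]] by blast
  ultimately show False by (metis not_one_le_zero order_trans)
qed

lemma busemann_plus:
  assumes "\<gamma> \<in> rays_plus"
  shows "ereal (busemann \<gamma> x) = b_plus \<gamma> x"
  unfolding busemann_def
  using assms by (intro horofunction_left_stable associated_ray left_stable_ray rays_plusD(3))

text \<open>If the rays differ in lamp \<open>k\<close> while the lamplighter is beyond
  \<open>k + B\<close>, the hull, and with it the distance, is longer than \<open>B\<close>.\<close>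

lemma ray_lit_asymptotic:
  assumes "(\<gamma>, \<gamma>') \<in> asymptotic_on rays_plus"
  shows "ray_lit \<gamma> = ray_lit \<gamma>'"
proof -
  have rays: "\<gamma> \<in> rays_plus" "\<gamma>' \<in> rays_plus" and "bdd_above (range (\<lambda>n. d (\<gamma> n) (\<gamma>' n)))"
    using assms by (auto simp: asymptotic_on_def)
  then obtain B where B: "d (\<gamma> n) (\<gamma>' n) \<le> B" for n
    by (auto simp: bdd_above_def)
  have "\<forall>\<^sub>F n in sequentially. k \<in> lit (\<gamma> n) \<longleftrightarrow> k \<in> lit (\<gamma>' n)" for k
    using rays_plusD(3)[OF rays(1), of "k + int B + 1"]
  proof eventually_elim
    case (elim n)
    show ?case
    proof (rule ccontr)
      assume "(k \<in> lit (\<gamma> n)) \<noteq> (k \<in> lit (\<gamma>' n))"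
      then have "low (\<gamma> n) (\<gamma>' n) \<le> k" by (rule low_le(3))
      moreover have "int (d (\<gamma> n) (\<gamma>' n)) \<le> int B" using B by simp
      moreover have "\<bar>H (\<gamma> n) - H (\<gamma>' n)\<bar> \<le> high (\<gamma> n) (\<gamma>' n) - low (\<gamma> n) (\<gamma>' n)"
        using low_le(1,2)[where g="\<gamma> n" and h="\<gamma>' n"]
          high_ge(1,2)[where g="\<gamma> n" and h="\<gamma>' n"] by (simp add: abs_if)
      moreover have "H (\<gamma> n) \<le> high (\<gamma> n) (\<gamma>' n)" by (rule high_ge(1))
      ultimately show False
        using elim d_tour[of "\<gamma> n" "\<gamma>' n"] by (simp add: tour_def)
    qed
  qed
  then have "(\<forall>\<^sub>F n in sequentially. k \<in> lit (\<gamma> n)) \<longleftrightarrow> (\<forall>\<^sub>F n in sequentially. k \<in> lit (\<gamma>' n))" for k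
    by (rule eventually_cong)
  then show ?thesis by (simp add: ray_lit_def)
qed

lemma tour_le_diff:
  assumes "\<And>n. adjacent (\<gamma> n) (\<gamma> (Suc n))" "i \<le> j"
  shows "tour (\<gamma> i) (\<gamma> j) \<le> int j - int i"
  using assms(2)
proof (induction j rule: dec_induct)
  case (step j)
  have "tour (\<gamma> j) (\<gamma> (Suc j)) \<le> 1"
    using tour_le_adjacent[OF assms(1), of j "\<gamma> (Suc j)"] by simp
  then show ?case
    using step.IH tour_triangle[of "\<gamma> i" "\<gamma> (Suc j)" "\<gamma> j"] by simp
qed simp

text \<open>Unit steps bound all distances from above. Any shortcut between two times would also
  shorten the way from the start.\<close>

lemma geodesic_rayI:
  assumes adj: "\<And>n. adjacent (\<gamma> n) (\<gamma> (Suc n))" and far: "\<And>n. int n \<le> tour (\<gamma> 0) (\<gamma> n)"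
  shows "geodesic_ray \<gamma>"
proof -
  have *: "tour (\<gamma> i) (\<gamma> j) = int j - int i" if "i \<le> j" for i j
    using tour_le_diff[of \<gamma>, OF adj that] tour_le_diff[of \<gamma>, OF adj, of 0 i]
      far[of j] tour_triangle[of "\<gamma> 0" "\<gamma> j" "\<gamma> i"] by simp
  have **: "real (d (\<gamma> i) (\<gamma> j)) = real j - real i" if "i \<le> j" for i j
    using *[OF that] that d_tour[of "\<gamma> i" "\<gamma> j"] by linarith
  have "real (d (\<gamma> i) (\<gamma> j)) = \<bar>real i - real j\<bar>" for i j
    using **[of i j] **[of j i] d_commute[of "\<gamma> i" "\<gamma> j"] by (cases "i \<le> j") auto
  then show ?thesis by (simp add: geodesic_ray_def)
qed

text \<open>
  The ray runs left to the leftmost lamp of the configuration (if that is negative), and then right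
  for ever, lighting the lamps that it passes.
\<close>

lemma ex_ray_plus:
  assumes fin: "\<And>p. finite (A \<inter> {..<p::int})"
  shows "\<exists>\<gamma>\<in>rays_plus. ray_lit \<gamma> = A"
proof -
  \<comment> \<open>The turning point; 0 is inserted so that the ray goes right at once if no
    negative lamp is lit.\<close>
  define M where "M = Min (insert 0 (A \<inter> {..<0}))"
  have "M \<le> 0" unfolding M_def using fin by (intro Min_le) auto
  have M_le: "M \<le> k" if "k \<in> A" for k
  proof (cases "k < 0")
    case True
    then show ?thesis unfolding M_def using fin that by (intro Min_le) auto
  qed (use \<open>M \<le> 0\<close> in simp)
  have "M \<in> insert 0 (A \<inter> {..<0})"
    unfolding M_def using fin by (intro Min_in) auto
  then have M_in: "M = 0 \<or> M \<in> A" by auto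
  define m where "m = nat (- M)"
  have m: "M = - int m" using \<open>M \<le> 0\<close> by (simp add: m_def)
  \<comment> \<open>Position -m is reached at time m, so at a later time n the lamplighter is at -m
    + (n - m) = n - 2m and has crossed, on the way right, exactly the edges from -m to n - 2m -
    1.\<close>
  define \<gamma> where "\<gamma> n = (if n \<le> m then stand {} (- int n)
      else stand (A \<inter> {..<int n - 2 * int m}) (int n - 2 * int m))" for n
  have H: "H (\<gamma> n) = (if n \<le> m then - int n else int n - 2 * int m)" for n
    by (simp add: \<gamma>_def)
  have lit: "lit (\<gamma> n) = (if n \<le> m then {} else A \<inter> {..<int n - 2 * int m})" for n
    by (simp add: \<gamma>_def fin)
  have zero: "\<gamma> 0 = \<one>\<^bsub>L2\<^esub>"
    by (rule lampstand_eqI) (simp_all add: H lit H_one lit_one)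
  have adj: "adjacent (\<gamma> n) (\<gamma> (Suc n))" for n
  proof (cases "n < m")
    case True
    then show ?thesis by (simp add: adjacent_def H lit)
  next
    case False
    have Hs: "H (\<gamma> n) = int n - 2 * int m" "H (\<gamma> (Suc n)) = int n - 2 * int m + 1"
      using False by (simp_all add: H)
    have *: "k = int n - 2 * int m" if "(k \<in> lit (\<gamma> n)) \<noteq> (k \<in> lit (\<gamma> (Suc n)))" for k
      using that False M_le[of k] m by (auto simp: lit split: if_splits)
    show ?thesis
      unfolding adjacent_def Hs by (intro conjI allI impI) (simp_all add: *)
  qed
  have far: "int n \<le> tour (\<gamma> 0) (\<gamma> n)" for n
  proof -
    note bounds = low_le(1,2)[where g="\<gamma> 0" and h="\<gamma> n"] high_ge(1,2)[where g="\<gamma> 0" and h="\<gamma> n"]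
    show ?thesis
    proof (cases "n \<le> m")
      case True
      then show ?thesis using bounds by (simp add: tour_def H)
    next
      case False
      \<comment> \<open>If m > 0, the lamp \<open>M\<close>, lit by the first step after the turn,
        makes the detour unavoidable; without it the path would not be geodesic.\<close>
      have "low (\<gamma> 0) (\<gamma> n) \<le> M"
      proof (cases "M = 0")
        case True
        then show ?thesis using bounds by (simp add: H)
      next
        case neq: False
        then have "M \<in> A" using M_in by simp
        then have "M \<in> lit (\<gamma> n)" using False m by (simp add: lit)
        then show ?thesis using lit[of 0] by (intro low_le(3)) simp
      qed
      then show ?thesis using False bounds m by (simp add: tour_def H abs_if)
    qed
  qed
  have "\<forall>\<^sub>F n in sequentially. p \<le> H (\<gamma> n)" for p
    using eventually_ge_at_top[of "nat p + 2 * m + 1"]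
    by eventually_elim (simp add: H)
  then have "\<gamma> \<in> rays_plus"
    using geodesic_rayI[of \<gamma>, OF adj far] zero by (simp add: rays_plus_def filterlim_at_top)
  moreover have "k \<in> ray_lit \<gamma> \<longleftrightarrow> k \<in> A" for k
  proof -
    have "\<forall>\<^sub>F n in sequentially. k \<in> lit (\<gamma> n) \<longleftrightarrow> k \<in> A"
      using eventually_ge_at_top[of "nat k + 2 * m + 1"]
    proof eventually_elim
      case (elim n)
      then have "\<not> n \<le> m" "k < int n - 2 * int m" by linarith+
      then show ?case by (simp add: lit)
    qed
    then have "(\<forall>\<^sub>F n in sequentially. k \<in> lit (\<gamma> n)) \<longleftrightarrow> (\<forall>\<^sub>F n::nat in sequentially. k \<in> A)"
      by (rule eventually_cong)
    then show ?thesis by (simp add: ray_lit_def)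
  qed
  ultimately show ?thesis by blast
qed

text \<open>\<open>b_plus\<close> depends on a sequence only through \<open>ray_lit\<close>, so a
  ray with the limit configuration of \<open>g\<close> has the same horofunction. The claim covers
  all asymptotic rays because boundary points are classes.\<close>

lemma horofunction_eq_busemann_plus:
  assumes assoc: "associated_with_horofunction g"
    and H: "\<And>p. \<forall>\<^sub>F n in sequentially. p \<le> H (g n)" and "left_stable g"
  shows "\<exists>\<gamma>\<in>rays_plus. \<forall>\<gamma>'. (\<gamma>, \<gamma>') \<in> asymptotic_on rays_plus \<longrightarrow>
    associated_with_horofunction \<gamma>' \<and> horofunction g = busemann \<gamma>' \<and>
    (\<forall>x. ereal (busemann \<gamma>' x) = b_plus \<gamma>' x)"
proof -
  obtain \<gamma> where \<gamma>: "\<gamma> \<in> rays_plus" "ray_lit \<gamma> = ray_lit g"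
    using ex_ray_plus[of "ray_lit g"] left_stable_ray_lit(2)[OF assoc H \<open>left_stable g\<close>] by blast
  have "associated_with_horofunction \<gamma>' \<and> horofunction g = busemann \<gamma>' \<and>
      (\<forall>x. ereal (busemann \<gamma>' x) = b_plus \<gamma>' x)"
    if asym: "(\<gamma>, \<gamma>') \<in> asymptotic_on rays_plus" for \<gamma>'
  proof -
    have \<gamma>': "\<gamma>' \<in> rays_plus" using asym by (simp add: asymptotic_on_def)
    have "ray_lit \<gamma>' = ray_lit g" using ray_lit_asymptotic[OF asym] \<gamma>(2) by simp
    then have "b_plus \<gamma>' x = b_plus g x" for x by (simp add: b_plus_def)
    then have "ereal (horofunction g x) = ereal (busemann \<gamma>' x)" for x
      using horofunction_left_stable[OF assoc H \<open>left_stable g\<close>] busemann_plus[OF \<gamma>'] by simp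
    then have "horofunction g = busemann \<gamma>'" by (simp add: fun_eq_iff)
    then show ?thesis using associated_ray[OF \<gamma>'] busemann_plus[OF \<gamma>'] by blast
  qed
  then show ?thesis using \<gamma>(1) by blast
qed

section \<open>Reflected statements for the remaining cases\<close>

lemma mirror_comp_mirror [simp]: "mirror \<circ> (mirror \<circ> g) = g"
  by (simp add: fun_eq_iff)

lemma rays_minus_mirror: "\<gamma> \<in> rays_minus \<longleftrightarrow> mirror \<circ> \<gamma> \<in> rays_plus"
proof -
  have "mirror (\<gamma> 0) = \<one>\<^bsub>L2\<^esub> \<longleftrightarrow> \<gamma> 0 = \<one>\<^bsub>L2\<^esub>"
    by (metis mirror_mirror mirror_one)
  moreover have "filterlim (\<lambda>n. - H (\<gamma> n)) at_top sequentially \<longleftrightarrow> filterlim (\<lambda>n. H (\<gamma> n)) at_bot sequentially"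
  proof -
    have "(\<forall>\<^sub>F n in sequentially. z \<le> - H (\<gamma> n)) \<longleftrightarrow> (\<forall>\<^sub>F n in sequentially. H (\<gamma> n) \<le> - z)" for z
      by (simp add: le_minus_iff)
    then show ?thesis
      unfolding filterlim_at_top filterlim_at_bot by (metis add.inverse_inverse)
  qed
  ultimately show ?thesis
    by (simp add: rays_plus_def rays_minus_def geodesic_ray_def d_mirror)
qed

lemma asymptotic_on_mirror:
  "(\<gamma>, \<gamma>') \<in> asymptotic_on rays_minus \<longleftrightarrow> (mirror \<circ> \<gamma>, mirror \<circ> \<gamma>') \<in> asymptotic_on rays_plus"
  by (simp add: asymptotic_on_def rays_minus_mirror d_mirror)

lemma horofunction_eq_busemann_minus:
  assumes assoc: "associated_with_horofunction g"
    and H: "\<And>p. \<forall>\<^sub>F n in sequentially. H (g n) \<le> p" and "right_stable g"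
  shows "\<exists>\<gamma>\<in>rays_minus. \<forall>\<gamma>'. (\<gamma>, \<gamma>') \<in> asymptotic_on rays_minus \<longrightarrow>
    associated_with_horofunction \<gamma>' \<and> horofunction g = busemann \<gamma>' \<and>
    (\<forall>x. ereal (busemann \<gamma>' x) = b_minus \<gamma>' x)"
proof -
  have assoc': "associated_with_horofunction (mirror \<circ> g)" and stable': "left_stable (mirror \<circ> g)"
    using assms by (simp_all only: horofunction_mirror stable_mirror)
  have H': "\<forall>\<^sub>F n in sequentially. p \<le> H ((mirror \<circ> g) n)" for p
    using H[of "- p"] by (rule eventually_mono) simp
  obtain \<gamma> where \<gamma>: "\<gamma> \<in> rays_plus" and asym: "\<And>\<gamma>'. (\<gamma>, \<gamma>') \<in> asymptotic_on rays_plus \<Longrightarrow>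
      associated_with_horofunction \<gamma>' \<and> horofunction (mirror \<circ> g) = busemann \<gamma>' \<and>
      (\<forall>x. ereal (busemann \<gamma>' x) = b_plus \<gamma>' x)"
    using horofunction_eq_busemann_plus[OF assoc' H' stable'] by blast
  have "associated_with_horofunction \<gamma>' \<and> horofunction g = busemann \<gamma>' \<and>
      (\<forall>x. ereal (busemann \<gamma>' x) = b_minus \<gamma>' x)"
    if "(mirror \<circ> \<gamma>, \<gamma>') \<in> asymptotic_on rays_minus" for \<gamma>'
  proof -
    have "(\<gamma>, mirror \<circ> \<gamma>') \<in> asymptotic_on rays_plus"
      using that by (simp only: asymptotic_on_mirror mirror_comp_mirror)
    note * = asym[OF this]
    have bus: "busemann \<gamma>' x = busemann (mirror \<circ> \<gamma>') (mirror x)" for x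
      unfolding busemann_def horofunction_mirror ..
    have "horofunction g x = busemann \<gamma>' x" for x
      using * horofunction_mirror(2)[of g x] bus by metis
    then show ?thesis
      using * bus by (auto simp only: horofunction_mirror b_minus_mirror fun_eq_iff)
  qed
  moreover have "mirror \<circ> \<gamma> \<in> rays_minus"
    using \<gamma> by (simp only: rays_minus_mirror mirror_comp_mirror)
  ultimately show ?thesis by blast
qed

lemma horofunction_right_stable_left_unstable:
  assumes assoc: "associated_with_horofunction g" and H: "\<forall>\<^sub>F n in sequentially. H (g n) = p"
    and "right_stable g" "\<not> left_stable g"
  shows "\<exists>f. H f = p \<and> min_pos (lit f) \<ge> ereal_int p \<and> (\<forall>x. ereal (horofunction g x) = r_minus f x)"
proof -
  have stable: "left_stable (mirror \<circ> g)" "\<not> right_stable (mirror \<circ> g)"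
    using assms stable_mirror[of g] stable_mirror[of "mirror \<circ> g"] by simp_all
  have assoc': "associated_with_horofunction (mirror \<circ> g)"
    using assoc by (simp only: horofunction_mirror)
  have H': "\<forall>\<^sub>F n in sequentially. H ((mirror \<circ> g) n) = - p"
    using H by (rule eventually_mono) simp
  obtain f where f: "H f = - p" "max_pos (lit f) < ereal_int (- p)"
      "\<And>x. ereal (horofunction (mirror \<circ> g) x) = r_plus f x"
    using horofunction_left_stable_right_unstable[OF assoc' H' stable] by blast
  \<comment> \<open>Reflection turns the strict bound k < -p for lamps of \<open>f\<close> into the
    non-strict bound p <= -1 - k.\<close>
  have "p \<le> - 1 - k" if "k \<in> lit f" for k
  proof -
    have "ereal_int k \<le> max_pos (lit f)"
      unfolding max_pos_def using that by (rule SUP_upper)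
    then have "ereal_int k < ereal_int (- p)" using f(2) by (rule le_less_trans)
    then show ?thesis by simp
  qed
  then have "ereal_int p \<le> min_pos (lit (mirror f))"
    unfolding min_pos_def lit_mirror by (intro INF_greatest) auto
  moreover have "ereal (horofunction g x) = r_minus (mirror f) x" for x
    using f(3)[of "mirror x"] by (simp only: horofunction_mirror r_minus_mirror mirror_mirror)
  ultimately show ?thesis
    using f(1) by (intro exI[of _ "mirror f"]) simp
qed

lemma horofunction_escape_left:
  assumes assoc: "associated_with_horofunction g"
    and H: "\<And>p. \<forall>\<^sub>F n in sequentially. H (g n) \<le> p" and "\<not> right_stable g"
  shows "horofunction g x = - of_int (H x)"
proof -
  have H': "\<forall>\<^sub>F n in sequentially. p \<le> H ((mirror \<circ> g) n)" for p
    using H[of "- p"] by (rule eventually_mono) simp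
  have "horofunction (mirror \<circ> g) (mirror x) = of_int (H (mirror x))"
    using assms by (intro horofunction_escape H') (simp_all only: horofunction_mirror stable_mirror not_False_eq_True)
  then show ?thesis by (simp only: horofunction_mirror H_mirror of_int_minus)
qed

theorem theorem5p13:
  fixes g :: "nat \<Rightarrow> lampstand" and l :: ereal
  assumes l: "l \<in> range ereal_int \<union> {\<infinity>, -\<infinity>}"
    and lim: "(\<lambda>n. ereal_int (H (g n))) \<longlonglongrightarrow> l"
    and assoc: "associated_with_horofunction g"
  shows
    "(l \<in> range ereal_int \<and> left_stable g \<and> right_stable g \<longrightarrow>
        (\<exists>g\<^sub>0. (\<forall>\<^sub>F n in sequentially. g n = g\<^sub>0) \<and> horofunction g = horo_embed g\<^sub>0 \<and>
           (\<forall>x. horofunction g x = real (d x g\<^sub>0) - real (d g\<^sub>0 \<one>\<^bsub>L2\<^esub>)))) \<and>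
     (l = \<infinity> \<and> left_stable g \<longrightarrow>
        (\<exists>\<xi>\<in>boundary_plus. \<forall>\<gamma>\<in>\<xi>. associated_with_horofunction \<gamma> \<and> horofunction g = busemann \<gamma> \<and>
           (\<forall>x. ereal (busemann \<gamma> x) = b_plus \<gamma> x))) \<and>
     (l = -\<infinity> \<and> right_stable g \<longrightarrow>
        (\<exists>\<xi>\<in>boundary_minus. \<forall>\<gamma>\<in>\<xi>. associated_with_horofunction \<gamma> \<and> horofunction g = busemann \<gamma> \<and>
           (\<forall>x. ereal (busemann \<gamma> x) = b_minus \<gamma> x))) \<and>
     (\<forall>p. l = ereal_int p \<and> \<not> left_stable g \<and> \<not> right_stable g \<longrightarrow>
        horofunction g = s_fun p) \<and>
     (\<forall>p. l = ereal_int p \<and> left_stable g \<and> \<not> right_stable g \<longrightarrow>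
        (\<exists>f. H f = p \<and> max_pos (lit f) < ereal_int p \<and>
           (\<forall>x. ereal (horofunction g x) = r_plus f x))) \<and>
     (\<forall>p. l = ereal_int p \<and> right_stable g \<and> \<not> left_stable g \<longrightarrow>
        (\<exists>f. H f = p \<and> min_pos (lit f) \<ge> ereal_int p \<and>
           (\<forall>x. ereal (horofunction g x) = r_minus f x))) \<and>
     (l = \<infinity> \<and> \<not> left_stable g \<longrightarrow> (\<forall>x. horofunction g x = of_int (H x))) \<and>
     (l = -\<infinity> \<and> \<not> right_stable g \<longrightarrow> (\<forall>x. horofunction g x = - of_int (H x)))"
proof -
  have fin: "\<forall>\<^sub>F n in sequentially. H (g n) = p" if "l = ereal_int p" for p
  proof -
    have "(\<lambda>n. real_of_int (H (g n))) \<longlonglongrightarrow> of_int p"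
      using lim that by simp
    then show ?thesis
      using eventually_const_of_tendsto_int by fastforce
  qed
  have plus: "\<forall>\<^sub>F n in sequentially. p \<le> H (g n)" if "l = \<infinity>" for p
  proof -
    have "\<forall>\<^sub>F n in sequentially. ereal_int p < ereal_int (H (g n))"
      using lim that by (intro order_tendstoD) auto
    then show ?thesis by (rule eventually_mono) simp
  qed
  have minus: "\<forall>\<^sub>F n in sequentially. H (g n) \<le> p" if "l = -\<infinity>" for p
  proof -
    have "\<forall>\<^sub>F n in sequentially. ereal_int (H (g n)) < ereal_int p"
      using lim that by (intro order_tendstoD) auto
    then show ?thesis by (rule eventually_mono) simp
  qed
  show ?thesis
  proof (intro conjI impI allI)
    assume *: "l \<in> range ereal_int \<and> left_stable g \<and> right_stable g"
    then obtain p where "l = ereal_int p" by blast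
    then obtain g\<^sub>0 where "\<forall>\<^sub>F n in sequentially. g n = g\<^sub>0" and eq: "horofunction g = horo_embed g\<^sub>0"
      using horofunction_both_stable[OF assoc fin] * by blast
    moreover have "horofunction g x = real (d x g\<^sub>0) - real (d g\<^sub>0 \<one>\<^bsub>L2\<^esub>)" for x
      unfolding eq horo_embed_def by (simp only: d_commute[of x])
    ultimately show "\<exists>g\<^sub>0. (\<forall>\<^sub>F n in sequentially. g n = g\<^sub>0) \<and> horofunction g = horo_embed g\<^sub>0 \<and>
        (\<forall>x. horofunction g x = real (d x g\<^sub>0) - real (d g\<^sub>0 \<one>\<^bsub>L2\<^esub>))"
      by blast
  next
    assume *: "l = \<infinity> \<and> left_stable g"
    then obtain \<gamma> where \<gamma>: "\<gamma> \<in> rays_plus" and "\<And>\<gamma>'. (\<gamma>, \<gamma>') \<in> asymptotic_on rays_plus \<Longrightarrow>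
        associated_with_horofunction \<gamma>' \<and> horofunction g = busemann \<gamma>' \<and>
        (\<forall>x. ereal (busemann \<gamma>' x) = b_plus \<gamma>' x)"
      using horofunction_eq_busemann_plus[OF assoc plus] by blast
    then show "\<exists>\<xi>\<in>boundary_plus. \<forall>\<gamma>\<in>\<xi>. associated_with_horofunction \<gamma> \<and> horofunction g = busemann \<gamma> \<and>
        (\<forall>x. ereal (busemann \<gamma> x) = b_plus \<gamma> x)"
      \<comment> \<open>The class of the ray is its image under the asymptotic relation, so
        membership in it is asymptoticity.\<close>
      unfolding boundary_plus_def by (intro bexI[OF _ quotientI[OF \<gamma>]]) simp
  next
    assume *: "l = -\<infinity> \<and> right_stable g"
    then obtain \<gamma> where \<gamma>: "\<gamma> \<in> rays_minus" and "\<And>\<gamma>'. (\<gamma>, \<gamma>') \<in> asymptotic_on rays_minus \<Longrightarrow>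
        associated_with_horofunction \<gamma>' \<and> horofunction g = busemann \<gamma>' \<and>
        (\<forall>x. ereal (busemann \<gamma>' x) = b_minus \<gamma>' x)"
      using horofunction_eq_busemann_minus[OF assoc minus] by blast
    then show "\<exists>\<xi>\<in>boundary_minus. \<forall>\<gamma>\<in>\<xi>. associated_with_horofunction \<gamma> \<and> horofunction g = busemann \<gamma> \<and>
        (\<forall>x. ereal (busemann \<gamma> x) = b_minus \<gamma> x)"
      unfolding boundary_minus_def by (intro bexI[OF _ quotientI[OF \<gamma>]]) simp
  next
    fix p assume "l = ereal_int p \<and> \<not> left_stable g \<and> \<not> right_stable g"
    then show "horofunction g = s_fun p"
      by (intro horofunction_left_right_unstable[OF assoc fin]) simp_all
  next
    fix p assume "l = ereal_int p \<and> left_stable g \<and> \<not> right_stable g"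
    then show "\<exists>f. H f = p \<and> max_pos (lit f) < ereal_int p \<and> (\<forall>x. ereal (horofunction g x) = r_plus f x)"
      by (intro horofunction_left_stable_right_unstable[OF assoc fin]) simp_all
  next
    fix p assume "l = ereal_int p \<and> right_stable g \<and> \<not> left_stable g"
    then show "\<exists>f. H f = p \<and> min_pos (lit f) \<ge> ereal_int p \<and> (\<forall>x. ereal (horofunction g x) = r_minus f x)"
      by (intro horofunction_right_stable_left_unstable[OF assoc fin]) simp_all
  next
    fix x assume "l = \<infinity> \<and> \<not> left_stable g"
    then show "horofunction g x = of_int (H x)"
      by (intro horofunction_escape[OF assoc plus]) simp_all
  next
    fix x assume "l = -\<infinity> \<and> \<not> right_stable g"
    then show "horofunction g x = - of_int (H x)"
      by (intro horofunction_escape_left[OF assoc minus]) simp_all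
  qed
qed

end
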